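(* Let $X\subseteq I$, and identify $A_X$ with its image in $A_I$ (and likewise for all subsets of $I$). Then: (i) The map $\pi_{I,X}:A_I\to A_X$ is a retraction, i.e. $\pi_{I,X}(g)=g$ for every $g\in A_X$. (ii) For any $g\in A_X$ and any $g'\in A_I$, one has $\pi_{I,X}(gg')=g\,\pi_{I,X}(g')$. (iii) Let $X,Y\subseteq I$. For any $g\in A_I$, $\pi_{I,Y}(\pi_{I,X}(g))=\pi_{I,X}(\pi_{I,Y}(g))=\pi_{I,X\cap Y}(g)$. (iv) Let $X\subseteq Y\subseteq I$. Then (a) the restriction of $\pi_{I,X}$ to $A_Y$ is $\pi_{Y,X}$; and (b) for any $g\in A_I$, $\pi_{Y,X}(\pi_{I,Y}(g))=\pi_{I,X}(g)$.
   Context: $\Gamma=(I,E,m)$ is a finite simplicial graph with edge labelling $m:E\to\mathbb{N}_{\ge 2}$; write $m(i,j)=m(\{i,j\})$. The Artin-Tits group $A_I$ is generated by $\Sigma_I=\{\sigma_i\mid i\in I\}$ with relations $\sigma_i\sigma_j\sigma_i\cdots=\sigma_j\sigma_i\sigma_j\cdots$ ($m(i,j)$ terms on each side) for $\{i,j\}\in E$; the Coxeter group $W_I$ is generated by $S_I=\{s_i\mid i\in I\}$ with the corresponding relations $s_is_js_i\cdots=s_js_is_j\cdots$ together with $s_i^2=1$. For $X\subseteq I$, $\Sigma_X=\{\sigma_i\mid i\in X\}$, $S_X=\{s_i\mid i\in X\}$, and $A_X$, $W_X$ are the Artin-Tits and Coxeter groups of the full labelled subgraph spanned by $X$; the natural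 maps $A_X\to A_I$ and $W_X\to W_I$ are injective, and $A_X$, $W_X$ are identified with their images. For a set $S$, $S^*$ denotes the monoid of words on $S$. For a word $w=s_{i_1}\cdots s_{i_k}$ on $S_I$ let $r_j(w)=s_{i_1}\cdots s_{i_{j-1}}s_{i_j}s_{i_{j-1}}\cdots s_{i_1}\in W_I$ for $1\le j\le k$, and $R(w)=(r_1(w),\dots,r_k(w))$. Definition of $\pi^*_{I,X}:(\Sigma_I\cup\Sigma_I^{-1})^*\to(\Sigma_X\cup\Sigma_X^{-1})^*$: given $\omega=\sigma_{i_1}^{\varepsilon_1}\cdots\sigma_{i_k}^{\varepsilon_k}$ with $\varepsilon_j\in\{\pm1\}$, put $w=s_{i_1}\cdots s_{i_k}$, and let $j_1<\dots<j_p$ be the indices $j$ for which $r_j(w)\in W_X$. There is a unique word $w_X=s_{q_1}\cdots s_{q_p}$ on $S_X$ with $R(w_X)=(r_{j_1}(w),\dots,r_{j_p}(w))$; set $\pi^*_{I,X}(\omega)=\sigma_{q_1}^{\varepsilon_{j_1}}\cdots\sigma_{q_p}^{\varepsilon_{j_p}}$. Two words representing the same element of $A_I$ have images representing the same element of $A_X$, so $\pi^*_{I,X}$ induces a map of sets $\pi_{I,X}:A_I\to A_X$. For $X\subseteq Y\subseteq I$ the map $\pi_{Y,X}:A_Y\to A_X$ is defined in the same way with $Y$ (and the full labelled subgraph spanned by $Y$) in place of $I$. *)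

theory Defs
  imports "HOL-Algebra.Group" "HOL-Library.FuncSet"
begin

section \<open>Groups given by generators and relations\<close>

text \<open>The signed letter \<open>(a, True)\<close> stands for the generator \<open>a\<close>, and \<open>(a, False)\<close> for its
  formal inverse.\<close>

type_synonym 'a sword = "('a \<times> bool) list"

definition swords :: "'a set \<Rightarrow> 'a sword set" where
  "swords S = lists (S \<times> UNIV)"

inductive_set pres_rel :: "'a set \<Rightarrow> ('a sword \<times> 'a sword) set \<Rightarrow> ('a sword \<times> 'a sword) set"
  for S :: "'a set" and R :: "('a sword \<times> 'a sword) set"
where
  pres_refl: "u \<in> swords S \<Longrightarrow> (u, u) \<in> pres_rel S R"
| pres_sym: "(u, v) \<in> pres_rel S R \<Longrightarrow> (v, u) \<in> pres_rel S R"
| pres_trans: "(u, v) \<in> pres_rel S R \<Longrightarrow> (v, w) \<in> pres_rel S R \<Longrightarrow> (u, w) \<in> pres_rel S R"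
| pres_cancel: "a \<in> S \<Longrightarrow> ([(a, e), (a, \<not> e)], []) \<in> pres_rel S R"
| pres_relator: "(u, v) \<in> R \<Longrightarrow> u \<in> swords S \<Longrightarrow> v \<in> swords S \<Longrightarrow> (u, v) \<in> pres_rel S R"
| pres_append: "(u, u') \<in> pres_rel S R \<Longrightarrow> (v, v') \<in> pres_rel S R \<Longrightarrow>
    (u @ v, u' @ v') \<in> pres_rel S R"

definition presented_group ::
    "'a set \<Rightarrow> ('a sword \<times> 'a sword) set \<Rightarrow> 'a sword set monoid" where
  "presented_group S R =
    \<lparr>carrier = swords S // pres_rel S R,
     mult = (\<lambda>g h. \<Union>u\<in>g. \<Union>v\<in>h. pres_rel S R `` {u @ v}),
     one = pres_rel S R `` {[]}\<rparr>"

lemma pres_rel_swords: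
  assumes "(u, v) \<in> pres_rel S R"
  shows "u \<in> swords S \<and> v \<in> swords S"
  using assms by induction (auto simp: swords_def)

lemma equiv_pres_rel: "equiv (swords S) (pres_rel S R)"
  by (rule equivI)
    (auto intro!: refl_onI symI transI intro: pres_refl pres_sym pres_trans dest: pres_rel_swords)

lemma presented_group_mult:
  assumes "u \<in> swords S" "v \<in> swords S"
  shows "pres_rel S R `` {u} \<otimes>\<^bsub>presented_group S R\<^esub> pres_rel S R `` {v} =
    pres_rel S R `` {u @ v}"
proof -
  have "congruent2 (pres_rel S R) (pres_rel S R) (\<lambda>u v. pres_rel S R `` {u @ v})"
    by (rule congruent2I')
      (metis equiv_class_eq equiv_pres_rel pres_append)
  then show ?thesis
    using UN_equiv_class2[OF equiv_pres_rel equiv_pres_rel] assms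
    by (simp add: presented_group_def)
qed

lemma group_presented_group: "group (presented_group S R)"
proof (rule groupI)
  let ?G = "presented_group S R" and ?c = "\<lambda>u. pres_rel S R `` {u}"
  have car: "x \<in> carrier ?G \<longleftrightarrow> (\<exists>u\<in>swords S. x = ?c u)" for x
    by (auto simp: presented_group_def quotient_def)
  have app: "u @ v \<in> swords S" if "u \<in> swords S" "v \<in> swords S" for u v
    using that by (auto simp: swords_def)
  have nil: "[] \<in> swords S" by (simp add: swords_def)
  have one: "\<one>\<^bsub>?G\<^esub> = ?c []" by (simp add: presented_group_def)
  show "\<one>\<^bsub>?G\<^esub> \<in> carrier ?G" using nil one car by blast
  show "x \<otimes>\<^bsub>?G\<^esub> y \<in> carrier ?G" if "x \<in> carrier ?G" "y \<in> carrier ?G" for x y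
    using that app by (auto simp: car presented_group_mult)
  show "x \<otimes>\<^bsub>?G\<^esub> y \<otimes>\<^bsub>?G\<^esub> z = x \<otimes>\<^bsub>?G\<^esub> (y \<otimes>\<^bsub>?G\<^esub> z)"
    if "x \<in> carrier ?G" "y \<in> carrier ?G" "z \<in> carrier ?G" for x y z
    using that app by (auto simp: car presented_group_mult)
  show "\<one>\<^bsub>?G\<^esub> \<otimes>\<^bsub>?G\<^esub> x = x" if "x \<in> carrier ?G" for x
    using that nil by (auto simp: car one presented_group_mult)
  have inverse: "\<exists>v\<in>swords S. (v @ u, []) \<in> pres_rel S R" if "u \<in> swords S" for u
    using that
  proof (induction u)
    case Nil
    then show ?case using nil pres_refl[OF nil] by force
  next
    case (Cons x u)
    obtain a e where x: "x = (a, e)" by (cases x)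
    from Cons.prems have aS: "a \<in> S" and uS: "u \<in> swords S" by (auto simp: swords_def x)
    with Cons.IH obtain v where v: "v \<in> swords S" "(v @ u, []) \<in> pres_rel S R" by blast
    have "([(a, \<not> e), (a, e)], []) \<in> pres_rel S R"
      using pres_cancel[OF aS, of "\<not> e" R] by simp
    from pres_append[OF this pres_refl[OF uS]]
    have "((a, \<not> e) # (a, e) # u, u) \<in> pres_rel S R" by simp
    from pres_append[OF pres_refl[OF v(1)] this]
    have "(v @ (a, \<not> e) # (a, e) # u, v @ u) \<in> pres_rel S R" .
    from pres_trans[OF this v(2)]
    have "((v @ [(a, \<not> e)]) @ x # u, []) \<in> pres_rel S R" by (simp add: x)
    moreover have "v @ [(a, \<not> e)] \<in> swords S" using v(1) aS by (auto simp: swords_def)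
    ultimately show ?case by blast
  qed
  show "\<exists>y\<in>carrier ?G. y \<otimes>\<^bsub>?G\<^esub> x = \<one>\<^bsub>?G\<^esub>" if "x \<in> carrier ?G" for x
  proof -
    from that obtain u where u: "u \<in> swords S" "x = ?c u" by (auto simp: car)
    obtain v where v: "v \<in> swords S" "(v @ u, []) \<in> pres_rel S R" using inverse[OF u(1)] by blast
    have "?c v \<otimes>\<^bsub>?G\<^esub> x = \<one>\<^bsub>?G\<^esub>"
      using u v equiv_class_eq[OF equiv_pres_rel v(2)] by (simp add: presented_group_mult one)
    then show ?thesis using v(1) car by blast
  qed
qed


section \<open>Artin-Tits groups and Coxeter groups\<close>

record 'a lgraph =
  verts :: "'a set"
  edges :: "'a set set"
  label :: "'a set \<Rightarrow> nat"

text \<open>Values of \<open>label\<close> outside the edge set are irrelevant; a pair of vertices that is not an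
  edge is subject to no braid relation.\<close>

definition labelled_simplicial_graph :: "'a lgraph \<Rightarrow> bool" where
  "labelled_simplicial_graph \<Gamma> \<longleftrightarrow>
    finite (verts \<Gamma>) \<and>
    (\<forall>e\<in>edges \<Gamma>. e \<subseteq> verts \<Gamma> \<and> card e = 2) \<and>
    (\<forall>e\<in>edges \<Gamma>. 2 \<le> label \<Gamma> e)"

definition full_subgraph :: "'a lgraph \<Rightarrow> 'a set \<Rightarrow> 'a lgraph" where
  "full_subgraph \<Gamma> X = \<lparr>verts = X, edges = {e \<in> edges \<Gamma>. e \<subseteq> X}, label = label \<Gamma>\<rparr>"

definition alternating :: "nat \<Rightarrow> 'a \<Rightarrow> 'a \<Rightarrow> 'a sword" where
  "alternating n i j = map (\<lambda>k. (if even k then i else j, True)) [0..<n]"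

definition braid_relations :: "'a lgraph \<Rightarrow> ('a sword \<times> 'a sword) set" where
  "braid_relations \<Gamma> =
    {(alternating (label \<Gamma> {i, j}) i j, alternating (label \<Gamma> {i, j}) j i) | i j.
      {i, j} \<in> edges \<Gamma>}"

definition coxeter_relations :: "'a lgraph \<Rightarrow> ('a sword \<times> 'a sword) set" where
  "coxeter_relations \<Gamma> =
    braid_relations \<Gamma> \<union> {([(i, True), (i, True)], []) | i. i \<in> verts \<Gamma>}"

definition artin_group :: "'a lgraph \<Rightarrow> 'a sword set monoid" where
  "artin_group \<Gamma> = presented_group (verts \<Gamma>) (braid_relations \<Gamma>)"

definition coxeter_group :: "'a lgraph \<Rightarrow> 'a sword set monoid" where
  "coxeter_group \<Gamma> = presented_group (verts \<Gamma>) (coxeter_relations \<Gamma>)"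

definition artin_class :: "'a lgraph \<Rightarrow> 'a sword \<Rightarrow> 'a sword set" where
  "artin_class \<Gamma> \<omega> = pres_rel (verts \<Gamma>) (braid_relations \<Gamma>) `` {\<omega>}"

definition coxeter_class :: "'a lgraph \<Rightarrow> 'a list \<Rightarrow> 'a sword set" where
  "coxeter_class \<Gamma> w =
    pres_rel (verts \<Gamma>) (coxeter_relations \<Gamma>) `` {map (\<lambda>i. (i, True)) w}"

text \<open>The natural maps \<open>A\<^sub>X \<rightarrow> A\<^sub>I\<close> and \<open>W\<^sub>X \<rightarrow> W\<^sub>I\<close>, for \<open>\<Gamma>\<close> the graph on \<open>I\<close>: an element of the
  group on \<open>X\<close> is a set of words, and the image below is the set of all words over \<open>I\<close> that are
  equivalent over \<open>I\<close> to one, hence to each, of them.\<close>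

definition artin_incl :: "'a lgraph \<Rightarrow> 'a sword set \<Rightarrow> 'a sword set" where
  "artin_incl \<Gamma> g = pres_rel (verts \<Gamma>) (braid_relations \<Gamma>) `` g"

definition coxeter_incl :: "'a lgraph \<Rightarrow> 'a sword set \<Rightarrow> 'a sword set" where
  "coxeter_incl \<Gamma> g = pres_rel (verts \<Gamma>) (coxeter_relations \<Gamma>) `` g"

definition coxeter_parabolic :: "'a lgraph \<Rightarrow> 'a set \<Rightarrow> 'a sword set set" where
  "coxeter_parabolic \<Gamma> X = coxeter_incl \<Gamma> ` carrier (coxeter_group (full_subgraph \<Gamma> X))"


section \<open>The retraction\<close>

text \<open>Positions in words are counted from 0, so \<open>refl_seq \<Gamma> w ! j\<close> is \<open>r\<^sub>j\<^sub>+\<^sub>1(w)\<close> in the usual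
  numbering from 1, and \<open>refl_seq \<Gamma> w\<close> is \<open>R(w)\<close>.\<close>

definition refl_seq :: "'a lgraph \<Rightarrow> 'a list \<Rightarrow> 'a sword set list" where
  "refl_seq \<Gamma> w =
    map (\<lambda>j. coxeter_class \<Gamma> (take j w @ [w ! j] @ rev (take j w))) [0..<length w]"

text \<open>The map \<open>\<pi>\<^sup>*\<close> on words. As \<open>W\<^sub>X\<close> is identified with a subgroup of \<open>W\<^sub>I\<close>, the sequence \<open>R(w\<^sub>X)\<close>
  is computed in \<open>W\<^sub>I\<close>.\<close>

definition retr_word :: "'a lgraph \<Rightarrow> 'a set \<Rightarrow> 'a sword \<Rightarrow> 'a sword" where
  "retr_word \<Gamma> X \<omega> =
    (let rs = refl_seq \<Gamma> (map fst \<omega>);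
         js = filter (\<lambda>j. rs ! j \<in> coxeter_parabolic \<Gamma> X) [0..<length \<omega>];
         wX = (THE v. v \<in> lists X \<and> refl_seq \<Gamma> v = map (\<lambda>j. rs ! j) js)
     in zip wX (map (\<lambda>j. snd (\<omega> ! j)) js))"

text \<open>The map \<open>\<pi>\<close> that \<open>\<pi>\<^sup>*\<close> induces from the Artin-Tits group on \<open>\<Gamma>\<close> to the one on \<open>X\<close>.\<close>

definition retr :: "'a lgraph \<Rightarrow> 'a set \<Rightarrow> 'a sword set \<Rightarrow> 'a sword set" where
  "retr \<Gamma> X g = (THE h. \<forall>\<omega>\<in>g. h = artin_class (full_subgraph \<Gamma> X) (retr_word \<Gamma> X \<omega>))"

end

theory Submission
  imports Defs Complex_Main
begin

text \<open>Read a signed word \<open>\<omega>\<close> letter by letter and remember the group element \<open>w\<close> of \<open>W\<^sub>I\<close> spelled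
  so far as \<open>w = x u\<close> with \<open>x \<in> W\<^sub>X\<close> and \<open>u\<close> the shortest element of its coset \<open>W\<^sub>X w\<close>. The next
  letter \<open>i\<close> contributes the reflection \<open>w s\<^sub>i w\<inverse>\<close>, which lies in \<open>W\<^sub>X\<close> if and only if \<open>u s\<^sub>i u\<inverse>\<close>
  does. If it does not, then \<open>u s\<^sub>i\<close> is again shortest in its coset and nothing is written. If it does,
  then \<open>u s\<^sub>i u\<inverse>\<close> is a generator \<open>s\<^sub>q\<close> with \<open>q \<in> X\<close>, the letter \<open>q\<close> is written with the sign of
  \<open>i\<close>, and the state stays \<open>u\<close>. So \<open>\<pi>\<^sup>*\<close> is computed by a transducer (\<open>run\<close>) whose states are the
  shortest coset representatives, starting at the identity.

  Lengths are replaced throughout by inversion sets. The parity with which a reflection occurs in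
  \<open>R(w)\<close> depends only on the element spelled by \<open>w\<close>, because the two sides of a braid relation have
  the same reflections in opposite orders; \<open>Inv g\<close> collects the reflections that occur an odd
  number of times. The representative \<open>u\<close> is characterised by \<open>Inv u \<inter> W\<^sub>X = {}\<close>, and the cocycle
  identity for \<open>Inv (g h)\<close> together with the absence of repetitions in shortest words yields both
  \<open>u s\<^sub>i u\<inverse> = s\<^sub>q\<close> (\<open>reduced_conj_simple\<close>) and the form of the intersections
  \<open>W\<^sub>J \<inter> d\<inverse> W\<^sub>X d\<close> (\<open>par_inter_conj\<close>).

  That \<open>\<pi>\<^sup>*\<close> respects relations is then a check from every state. For a braid relation between
  \<open>i\<close> and \<open>j\<close>, the conjugate of \<open>W\<^bsub>{i,j}\<^esub>\<close> by the state either lies in \<open>W\<^sub>X\<close>, and a braid relation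
  of the same length is written, or contains at most one reflection of \<open>W\<^sub>X\<close>, and both sides write
  the same word of length at most 1 (\<open>dihedral_dichotomy\<close>, \<open>run_braid\<close>). Equality of the labels needs
  the exact orders of the products \<open>s\<^sub>i s\<^sub>j\<close>, and uniqueness of \<open>w\<^sub>X\<close> needs distinct generators; both are
  read off the reflection representation.

  The four assertions follow on the level of words. A word over \<open>X\<close> has all its reflections in \<open>W\<^sub>X\<close>, so
  it is fixed and leaves the transducer in its initial state, which gives the retraction and left
  equivariance. Both composites of the maps to \<open>X\<close> and \<open>Y\<close> keep exactly the reflections in
  \<open>W\<^sub>X \<inter> W\<^sub>Y\<close>; as a word is determined by its reflections, they agree and are words over \<open>X \<inter> Y\<close>
  (\<open>run_run\<close>). Finally, the maps for \<open>I\<close> and for \<open>Y\<close> agree on words over \<open>Y\<close> because \<open>W\<^sub>Y\<close> embeds in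
  \<open>W\<^sub>I\<close>, and this embedding is itself a consequence of \<open>\<pi>\<^sup>*\<close> fixing words over \<open>Y\<close> and respecting the
  Coxeter relations (\<open>pi_word_subgraph\<close>).\<close>

section \<open>Signed and alternating words\<close>

(* Membership in lists is kept folded, so that facts of the form w \<in> lists A match each other. *)
declare in_listsD [rule del] in_listsI [rule del]

lemma rev_in_lists [simp]: "rev w \<in> lists A \<longleftrightarrow> w \<in> lists A"
  by (simp add: in_lists_conv_set)

lemma take_in_lists [simp]: "w \<in> lists A \<Longrightarrow> take n w \<in> lists A"
  by (auto simp: in_lists_conv_set dest: in_set_takeD)

fun alt :: "nat \<Rightarrow> 'a \<Rightarrow> 'a \<Rightarrow> 'a list" where
  "alt 0 i j = []"
| "alt (Suc n) i j = i # alt n j i"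

lemma length_alt [simp]: "length (alt n i j) = n"
  by (induction n arbitrary: i j) auto

lemma set_alt: "set (alt n i j) \<subseteq> {i, j}"
  by (induction n arbitrary: i j) (simp, fastforce)

lemma alt_lists [simp]: "i \<in> X \<Longrightarrow> j \<in> X \<Longrightarrow> alt n i j \<in> lists X"
  using set_alt[of n i j] by (auto simp: in_lists_conv_set)

lemma alt_snoc: "alt (2 * n) i j @ [i] = i # alt (2 * n) j i"
  by (induction n) auto

text \<open>This turns a braid relation into a statement about the power \<open>(i j)\<^sup>n\<close> and back.\<close>

lemma alt_double: "alt (2 * n) i j = alt n i j @ rev (alt n j i)"
proof (induction n arbitrary: i j)
  case (Suc n)
  have "alt (2 * Suc n) i j = i # (j # alt (2 * n) i j)" by simp
  also have "\<dots> = i # alt (2 * n) j i @ [j]" by (simp only: alt_snoc)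
  finally show ?case using Suc by simp
qed simp

lemma alternating_eq_alt: "alternating n i j = map (\<lambda>k. (k, True)) (alt n i j)"
proof (induction n arbitrary: i j)
  case (Suc n)
  have "alternating (Suc n) i j = (i, True) # alternating n j i"
    unfolding alternating_def by (subst upt_conv_Cons) (auto simp del: upt_Suc simp flip: map_Suc_upt)
  then show ?case using Suc by simp
qed (simp add: alternating_def)

lemma swords_Nil [simp]: "[] \<in> swords A"
  and swords_Cons [simp]: "x # \<omega> \<in> swords A \<longleftrightarrow> fst x \<in> A \<and> \<omega> \<in> swords A"
  and swords_append [simp]: "\<omega> @ \<omega>' \<in> swords A \<longleftrightarrow> \<omega> \<in> swords A \<and> \<omega>' \<in> swords A"
  by (cases x; auto simp: swords_def)+

lemma swords_iff: "\<omega> \<in> swords A \<longleftrightarrow> map fst \<omega> \<in> lists A"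
  by (induction \<omega>) auto

lemma map_fst_swords [simp]: "\<omega> \<in> swords A \<Longrightarrow> map fst \<omega> \<in> lists A"
  by (simp add: swords_iff)

lemma swords_mono: "X \<subseteq> Y \<Longrightarrow> \<omega> \<in> swords X \<Longrightarrow> \<omega> \<in> swords Y"
  unfolding swords_iff using lists_mono by blast

lemma map_fst_alternating: "map fst (alternating n i j) = alt n i j"
  by (simp add: alternating_eq_alt o_def)

lemma alternating_swords [simp]: "i \<in> X \<Longrightarrow> j \<in> X \<Longrightarrow> alternating n i j \<in> swords X"
  unfolding swords_iff map_fst_alternating by simp

section \<open>Words in involutions and their reflections\<close>

text \<open>Everything in this part holds before any braid relation is imposed. In particular it is available
  for proving that the Coxeter group has well-defined inversion sets.\<close>

locale involutions = group G for G (structure) +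
  fixes I :: "'i set" and s :: "'i \<Rightarrow> 'a"
  assumes s_closed [simp]: "i \<in> I \<Longrightarrow> s i \<in> carrier G"
    and s_sq [simp]: "i \<in> I \<Longrightarrow> s i \<otimes> s i = \<one>"
begin

definition conj_by :: "'a \<Rightarrow> 'a \<Rightarrow> 'a" where
  "conj_by g t = g \<otimes> t \<otimes> inv g"

fun ev :: "'i list \<Rightarrow> 'a" where
  "ev [] = \<one>"
| "ev (i # w) = s i \<otimes> ev w"

fun refls :: "'i list \<Rightarrow> 'a list" where
  "refls [] = []"
| "refls (i # w) = s i # map (conj_by (s i)) (refls w)"

text \<open>The parabolic subgroup \<open>W\<^sub>X\<close>.\<close>

definition par :: "'i set \<Rightarrow> 'a set" where
  "par X = ev ` lists X"

lemma left_cancel: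
  "g \<in> carrier G \<Longrightarrow> a \<in> carrier G \<Longrightarrow> b \<in> carrier G \<Longrightarrow> g \<otimes> a = g \<otimes> b \<longleftrightarrow> a = b"
  using Units_l_cancel[of g a b] by simp

lemma inv_s [simp]: "i \<in> I \<Longrightarrow> inv (s i) = s i"
  by (rule inv_equality) auto

lemma s_cancel [simp]: "i \<in> I \<Longrightarrow> g \<in> carrier G \<Longrightarrow> s i \<otimes> (s i \<otimes> g) = g"
  by (simp flip: m_assoc)

lemma ev_closed [simp]: "w \<in> lists I \<Longrightarrow> ev w \<in> carrier G"
  by (induction w) auto

lemma ev_append: "u \<in> lists I \<Longrightarrow> v \<in> lists I \<Longrightarrow> ev (u @ v) = ev u \<otimes> ev v"
  by (induction u) (auto simp: m_assoc)

lemma ev_rev: "w \<in> lists I \<Longrightarrow> ev (rev w) = inv (ev w)"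
  by (induction w) (auto simp: ev_append inv_mult_group)

lemma conj_by_closed [simp]:
  "g \<in> carrier G \<Longrightarrow> t \<in> carrier G \<Longrightarrow> conj_by g t \<in> carrier G"
  by (simp add: conj_by_def)

lemma conj_by_mult:
  assumes "g \<in> carrier G" "h \<in> carrier G" "t \<in> carrier G"
  shows "conj_by (g \<otimes> h) t = conj_by g (conj_by h t)"
  using assms by (simp add: conj_by_def m_assoc inv_mult_group)

lemma conj_by_one [simp]: "t \<in> carrier G \<Longrightarrow> conj_by \<one> t = t"
  by (simp add: conj_by_def)

lemma conj_by_inv [simp]:
  assumes "g \<in> carrier G" "t \<in> carrier G"
  shows "conj_by (inv g) (conj_by g t) = t" and "conj_by g (conj_by (inv g) t) = t"
  using assms by (simp_all flip: conj_by_mult)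

lemma conj_by_eq_iff:
  assumes "g \<in> carrier G" "t \<in> carrier G" "t' \<in> carrier G"
  shows "conj_by g t = conj_by g t' \<longleftrightarrow> t = t'"
  using assms by (metis conj_by_inv(1))

lemma conj_by_inv_eq_iff:
  assumes "g \<in> carrier G" "t \<in> carrier G" "z \<in> carrier G"
  shows "conj_by (inv g) t = z \<longleftrightarrow> t = conj_by g z"
  using assms by auto

lemma conj_by_hom:
  assumes "g \<in> carrier G" "a \<in> carrier G" "b \<in> carrier G"
  shows "conj_by g (a \<otimes> b) = conj_by g a \<otimes> conj_by g b"
proof -
  have "inv g \<otimes> (g \<otimes> x) = x" if "x \<in> carrier G" for x
    using that assms by (simp flip: m_assoc)
  then show ?thesis
    using assms by (simp add: conj_by_def m_assoc)
qed

lemma conj_by_id [simp]: "g \<in> carrier G \<Longrightarrow> conj_by g \<one> = \<one>"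
  by (simp add: conj_by_def)

lemma conj_by_self [simp]: "g \<in> carrier G \<Longrightarrow> conj_by g g = g"
  by (simp add: conj_by_def m_assoc)

lemma conj_by_pow:
  assumes "g \<in> carrier G" "a \<in> carrier G"
  shows "conj_by g (a [^] (n::nat)) = conj_by g a [^] n"
  using assms by (induction n) (auto simp: conj_by_hom)

lemma mult_conj_by:
  assumes "g \<in> carrier G" "a \<in> carrier G"
  shows "conj_by g a \<otimes> g = g \<otimes> a"
  using assms by (simp add: conj_by_def m_assoc)

lemma refls_closed [simp]: "w \<in> lists I \<Longrightarrow> set (refls w) \<subseteq> carrier G"
  by (induction w) auto

lemma refls_closed': "w \<in> lists I \<Longrightarrow> t \<in> set (refls w) \<Longrightarrow> t \<in> carrier G"
  using refls_closed by blast

lemma length_refls [simp]: "length (refls w) = length w"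
  by (induction w) auto

lemma refls_append:
  "u \<in> lists I \<Longrightarrow> v \<in> lists I \<Longrightarrow> refls (u @ v) = refls u @ map (conj_by (ev u)) (refls v)"
proof (induction u)
  case Nil
  have "map (conj_by \<one>) (refls v) = refls v"
    using refls_closed'[OF \<open>v \<in> lists I\<close>] by (intro map_idI) simp
  then show ?case by simp
next
  case (Cons i u)
  then show ?case
    using refls_closed'[OF \<open>v \<in> lists I\<close>] by (auto simp: conj_by_mult)
qed

lemma refls_nth:
  assumes "w \<in> lists I" "j < length w"
  shows "refls w ! j = ev (take j w @ [w ! j] @ rev (take j w))"
  using assms
proof (induction w arbitrary: j rule: list.induct)
  case (Cons i w)
  show ?case
  proof (cases j)
    case (Suc k)
    have k: "k < length w" and i: "i \<in> I" and w: "w \<in> lists I"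
      using Cons.prems Suc by auto
    have t: "take k w \<in> lists I" "w ! k \<in> I"
      using w k by (simp, simp add: in_lists_conv_set)
    show ?thesis
      using k i w t Cons.IH[OF w k] Suc
      by (simp add: conj_by_def ev_append m_assoc)
  qed (use Cons.prems in auto)
qed simp

lemma refls_split:
  assumes "w \<in> lists I" "t \<in> set (refls w)"
  shows "\<exists>a j b. w = a @ j # b \<and> t = conj_by (ev a) (s j)"
  using assms
proof (induction w arbitrary: t rule: list.induct)
  case (Cons i w)
  show ?case
  proof (cases "t = s i")
    case True
    have "i # w = [] @ i # w \<and> t = conj_by (ev []) (s i)"
      using True Cons.prems by (simp add: conj_by_def)
    then show ?thesis by blast
  next
    case False
    then obtain t' where t': "t' \<in> set (refls w)" "t = conj_by (s i) t'"
      using Cons.prems by auto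
    then obtain a j b where "w = a @ j # b" "t' = conj_by (ev a) (s j)"
      using Cons by force
    moreover from this have "t = conj_by (ev (i # a)) (s j)"
      using Cons.prems t' by (simp add: conj_by_mult)
    ultimately show ?thesis by (metis append_Cons)
  qed
qed simp

lemma count_list_map_conj:
  assumes "g \<in> carrier G" "set xs \<subseteq> carrier G" "t \<in> carrier G"
  shows "count_list (map (conj_by g) xs) t = count_list xs (conj_by (inv g) t)"
  using assms(2) by (induction xs) (use assms in auto)

lemma par_mono: "X \<subseteq> Y \<Longrightarrow> par X \<subseteq> par Y"
  unfolding par_def by (intro image_mono lists_mono)

lemma s_in_par: "i \<in> X \<Longrightarrow> i \<in> I \<Longrightarrow> s i \<in> par X"
  unfolding par_def by (rule image_eqI[of _ _ "[i]"]) auto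

lemma subgroup_par:
  assumes "X \<subseteq> I"
  shows "subgroup (par X) G"
proof
  have L: "w \<in> lists I" if "w \<in> lists X" for w using assms that lists_mono by blast
  show "par X \<subseteq> carrier G" by (auto simp: par_def dest: L)
  show "\<one> \<in> par X" unfolding par_def by (rule image_eqI[of _ _ "[]"]) auto
  show "x \<otimes> y \<in> par X" if xy: "x \<in> par X" "y \<in> par X" for x y
  proof -
    obtain u v where "u \<in> lists X" "v \<in> lists X" "x = ev u" "y = ev v"
      using xy unfolding par_def by blast
    then show ?thesis
      unfolding par_def using L by (intro image_eqI[of _ _ "u @ v"]) (auto simp: ev_append)
  qed
  show "inv x \<in> par X" if x: "x \<in> par X" for x
  proof -
    obtain u where "u \<in> lists X" "x = ev u"
      using x unfolding par_def by blast
    then show ?thesis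
      unfolding par_def using L by (intro image_eqI[of _ _ "rev u"]) (auto simp: ev_rev)
  qed
qed

lemma par_closed: "X \<subseteq> I \<Longrightarrow> g \<in> par X \<Longrightarrow> g \<in> carrier G"
  using subgroup.mem_carrier[OF subgroup_par] .

lemma par_mult: "X \<subseteq> I \<Longrightarrow> g \<in> par X \<Longrightarrow> h \<in> par X \<Longrightarrow> g \<otimes> h \<in> par X"
  using subgroup.m_closed[OF subgroup_par] .

lemma par_inv: "X \<subseteq> I \<Longrightarrow> g \<in> par X \<Longrightarrow> inv g \<in> par X"
  using subgroup.m_inv_closed[OF subgroup_par] .

lemma par_conj: "X \<subseteq> I \<Longrightarrow> g \<in> par X \<Longrightarrow> t \<in> par X \<Longrightarrow> conj_by g t \<in> par X"
  unfolding conj_by_def by (intro par_mult par_inv)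

lemma par_conj_iff:
  assumes "X \<subseteq> I" "g \<in> par X" "t \<in> carrier G"
  shows "conj_by g t \<in> par X \<longleftrightarrow> t \<in> par X"
  using assms par_conj[of X g t] par_conj[of X "inv g" "conj_by g t"]
  by (auto simp: par_inv par_closed)

lemma refls_in_par: "X \<subseteq> I \<Longrightarrow> w \<in> lists X \<Longrightarrow> set (refls w) \<subseteq> par X"
  by (induction w) (auto simp: s_in_par par_conj subsetD)

lemma s_pow_swap:
  assumes "i \<in> I" "j \<in> I"
  shows "s i \<otimes> (s j \<otimes> s i) [^] (n::nat) = (s i \<otimes> s j) [^] n \<otimes> s i"
proof (induction n)
  case (Suc n)
  let ?p = "s i \<otimes> s j" and ?q = "s j \<otimes> s i"
  have "s i \<otimes> ?q [^] Suc n = (s i \<otimes> ?q [^] n) \<otimes> ?q"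
    using assms by (simp add: m_assoc)
  also have "\<dots> = (?p [^] n \<otimes> s i) \<otimes> ?q"
    by (simp only: Suc)
  also have "\<dots> = ?p [^] Suc n \<otimes> s i"
    using assms by (simp add: m_assoc)
  finally show ?case .
qed (use assms in simp)

lemma pow_swap_cancel:
  assumes "i \<in> I" "j \<in> I"
  shows "(s j \<otimes> s i) [^] (n::nat) = inv ((s i \<otimes> s j) [^] n)"
proof -
  have "s j \<otimes> s i = inv (s i \<otimes> s j)" using assms by (simp add: inv_mult_group)
  then show ?thesis using assms by (simp add: nat_pow_inv)
qed

text \<open>Peeling the outer letters turns the quotient of the two sides of length \<open>n + 1\<close> into
  \<open>s i \<otimes> q \<otimes> s j\<close>, where \<open>q\<close> is the quotient of length \<open>n\<close> with \<open>i\<close> and \<open>j\<close> exchanged.\<close>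

lemma ev_alt_quotient:
  assumes "i \<in> I" "j \<in> I"
  shows "ev (alt n i j) \<otimes> inv (ev (alt n j i)) = (s i \<otimes> s j) [^] n"
  using assms
proof (induction n arbitrary: i j)
  case (Suc n)
  have "ev (alt (Suc n) i j) \<otimes> inv (ev (alt (Suc n) j i)) =
      s i \<otimes> (ev (alt n j i) \<otimes> inv (ev (alt n i j))) \<otimes> s j"
    using Suc.prems by (simp add: inv_mult_group m_assoc)
  also have "\<dots> = (s i \<otimes> s j) [^] Suc n"
    using Suc by (simp add: s_pow_swap m_assoc)
  finally show ?case .
qed simp

lemma ev_alt_eq_iff:
  assumes "i \<in> I" "j \<in> I"
  shows "ev (alt n i j) = ev (alt n j i) \<longleftrightarrow> (s i \<otimes> s j) [^] n = \<one>"
  using assms inv_solve_right'[of \<one> "ev (alt n i j)" "ev (alt n j i)"]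
  by (auto simp flip: ev_alt_quotient)

lemma refls_alt:
  assumes "i \<in> I" "j \<in> I"
  shows "refls (alt n i j) = map (\<lambda>k. (s i \<otimes> s j) [^] k \<otimes> s i) [0..<n]"
  using assms
proof (induction n arbitrary: i j)
  case (Suc n)
  have "conj_by (s i) ((s j \<otimes> s i) [^] k \<otimes> s j) = (s i \<otimes> s j) [^] Suc k \<otimes> s i" for k
    using Suc.prems s_pow_swap[of i j k] by (simp add: conj_by_def flip: m_assoc)
  then show ?case
    using Suc by (subst upt_conv_Cons) (auto simp del: upt_Suc simp flip: map_Suc_upt)
qed simp

text \<open>The reflections are \<open>p\<^sup>k s\<^sub>i\<close> on one side and \<open>p\<^bsup>-k\<^esup> s\<^sub>j = p\<^bsup>-(k+1)\<^esup> s\<^sub>i\<close> on the other, where \<open>p = s\<^sub>i s\<^sub>j\<close> has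
  \<open>m\<close>-th power \<open>\<one>\<close>.\<close>

lemma refls_alt_rev:
  assumes ij: "i \<in> I" "j \<in> I" and m: "(s i \<otimes> s j) [^] m = \<one>"
  shows "refls (alt m j i) = rev (refls (alt m i j))"
proof (rule nth_equalityI)
  fix k assume "k < length (refls (alt m j i))"
  then have k: "k < m" by simp
  let ?p = "s i \<otimes> s j" and ?q = "s j \<otimes> s i"
  have "?p [^] Suc k \<otimes> (?p [^] (m - Suc k) \<otimes> s i) = s i"
  proof -
    have "?p [^] Suc k \<otimes> ?p [^] (m - Suc k) = \<one>"
      using ij k m by (subst nat_pow_mult) auto
    then show ?thesis
      using ij by (metis l_one m_assoc m_closed nat_pow_closed s_closed)
  qed
  then have "?p [^] (m - Suc k) \<otimes> s i = inv (?p [^] Suc k) \<otimes> s i"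
    using ij by (metis inv_solve_left m_closed nat_pow_closed s_closed)
  also have "\<dots> = ?q [^] Suc k \<otimes> s i"
    by (simp only: pow_swap_cancel[OF ij])
  also have "\<dots> = ?q [^] k \<otimes> s j"
    using ij by (simp add: m_assoc)
  finally show "refls (alt m j i) ! k = rev (refls (alt m i j)) ! k"
    using k ij by (simp add: refls_alt rev_nth)
qed simp

end

section \<open>Inversions and reduced elements\<close>

text \<open>The assumptions are what remains of a Coxeter system once its relations are forgotten: \<open>parity\<close> is the
  existence of inversion sets, and \<open>s_indep\<close> says that no generator is redundant, in the strong
  form \<open>S \<inter> W\<^sub>X = S\<^sub>X\<close>.\<close>

locale reflection_system = involutions G I s for G (structure) and I :: "'i set" and s +
  assumes generated: "carrier G = ev ` lists I"
    and parity: "u \<in> lists I \<Longrightarrow> v \<in> lists I \<Longrightarrow> ev u = ev v \<Longrightarrow>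
      odd (count_list (refls u) t) = odd (count_list (refls v) t)"
    and s_indep: "X \<subseteq> I \<Longrightarrow> i \<in> I \<Longrightarrow> s i \<in> par X \<Longrightarrow> i \<in> X"
begin

definition Inv :: "'a \<Rightarrow> 'a set" where
  "Inv g = {t. \<exists>w\<in>lists I. g = ev w \<and> odd (count_list (refls w) t)}"

lemma Inv_ev: "w \<in> lists I \<Longrightarrow> Inv (ev w) = {t. odd (count_list (refls w) t)}"
  unfolding Inv_def using parity by blast

lemma wordE:
  assumes "g \<in> carrier G"
  obtains w where "w \<in> lists I" "g = ev w"
  using assms generated by auto

text \<open>The inversion set is a cocycle with values in sets of reflections under symmetric difference:
  \<open>R(u v)\<close> is \<open>R(u)\<close> followed by the conjugate of \<open>R(v)\<close>.\<close>

lemma Inv_mult: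
  assumes g: "g \<in> carrier G" and h: "h \<in> carrier G" and t: "t \<in> carrier G"
  shows "t \<in> Inv (g \<otimes> h) \<longleftrightarrow> (t \<in> Inv g) \<noteq> (conj_by (inv g) t \<in> Inv h)"
proof -
  obtain u where u: "u \<in> lists I" "g = ev u" using g by (rule wordE)
  obtain v where v: "v \<in> lists I" "h = ev v" using h by (rule wordE)
  have "Inv (g \<otimes> h) = Inv (ev (u @ v))" using u v by (simp add: ev_append)
  also have "\<dots> = {t. odd (count_list (refls (u @ v)) t)}"
    using u v by (intro Inv_ev) auto
  finally show ?thesis
    using u v g t by (simp add: refls_append Inv_ev count_list_map_conj)
qed

lemma Inv_one [simp]: "Inv \<one> = {}"
  using Inv_ev[of "[]"] by simp

lemma Inv_s [simp]: "i \<in> I \<Longrightarrow> Inv (s i) = {s i}"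
  using Inv_ev[of "[i]"] by (auto split: if_splits)

lemma Inv_inv:
  assumes "g \<in> carrier G" "t \<in> carrier G"
  shows "t \<in> Inv (inv g) \<longleftrightarrow> conj_by g t \<in> Inv g"
  using assms Inv_mult[of "inv g" g t] by simp

lemma Inv_par:
  assumes "X \<subseteq> I" "g \<in> par X"
  shows "Inv g \<subseteq> par X"
proof -
  obtain w where w: "w \<in> lists X" "g = ev w" using assms unfolding par_def by blast
  have "w \<in> lists I" using w assms(1) lists_mono by blast
  then have "Inv g \<subseteq> set (refls w)"
    using w by (auto simp: Inv_ev intro: ccontr simp: count_notin)
  with refls_in_par[OF assms(1) w(1)] show ?thesis by simp
qed

text \<open>If the reflection of the first letter came back later, both letters could be deleted without
  changing the element.\<close>

lemma distinct_refls_shortest: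
  assumes X: "X \<subseteq> I" and "w \<in> lists X"
    and "\<And>v. v \<in> lists X \<Longrightarrow> ev v = ev w \<Longrightarrow> length w \<le> length v"
  shows "distinct (refls w)"
  using assms(2,3)
proof (induction w rule: list.induct)
  case (Cons i w)
  have L: "v \<in> lists X \<Longrightarrow> v \<in> lists I" for v using X lists_mono by blast
  have i: "i \<in> I" "i \<in> X" and w: "w \<in> lists X" "w \<in> lists I" using Cons.prems(1) X L by auto
  have short: "length w \<le> length v" if "v \<in> lists X" "ev v = ev w" for v
    using Cons.prems(2)[of "i # v"] that i by simp
  have "s i \<notin> set (refls w)"
  proof
    assume "s i \<in> set (refls w)"
    then obtain a j b where ab: "w = a @ j # b" "s i = conj_by (ev a) (s j)"
      using refls_split w by blast
    then have l: "a \<in> lists I" "b \<in> lists I" "j \<in> I" "a @ b \<in> lists X" using w by auto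
    \<comment> \<open>Moving \<open>s i\<close> past \<open>ev a\<close> turns it into \<open>s j\<close>, which cancels the letter \<open>j\<close>.\<close>
    have "s i \<otimes> ev a = ev a \<otimes> s j"
      using ab(2) l mult_conj_by[of "ev a" "s j"] by simp
    then have "s i \<otimes> (ev a \<otimes> (s j \<otimes> ev b)) = ev a \<otimes> (s j \<otimes> (s j \<otimes> ev b))"
      using l i by (metis ev_closed m_assoc m_closed s_closed)
    then have "ev (i # w) = ev (a @ b)"
      using l by (simp add: ab(1) ev_append)
    with Cons.prems(2)[of "a @ b"] l ab(1) show False by simp
  qed
  moreover have "inj_on (conj_by (s i)) (set (refls w))"
    using i refls_closed'[OF w(2)] by (auto simp: inj_on_def conj_by_eq_iff)
  moreover have "s i \<notin> conj_by (s i) ` set (refls w)"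
  proof
    assume "s i \<in> conj_by (s i) ` set (refls w)"
    then obtain t where t: "t \<in> set (refls w)" "s i = conj_by (s i) t" by blast
    then have "t = s i"
      using i refls_closed'[OF w(2)] conj_by_eq_iff[of "s i" "s i" t] by auto
    with t \<open>s i \<notin> set (refls w)\<close> show False by simp
  qed
  ultimately show ?case
    using Cons.IH[OF w(1) short] by (simp add: distinct_map)
qed simp

lemma odd_count_distinct: "distinct xs \<Longrightarrow> odd (count_list xs t) \<longleftrightarrow> t \<in> set xs"
  by (induction xs) auto

lemma distinct_wordE:
  assumes X: "X \<subseteq> I" and g: "g \<in> par X"
  obtains w where "w \<in> lists X" "g = ev w" "distinct (refls w)" "Inv g = set (refls w)"
proof -
  have "\<exists>w. w \<in> lists X \<and> ev w = g" using g unfolding par_def by blast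
  then obtain w where w: "w \<in> lists X" "ev w = g"
    and short: "\<And>v. v \<in> lists X \<and> ev v = g \<Longrightarrow> length w \<le> length v"
    using ex_has_least_nat[of "\<lambda>w. w \<in> lists X \<and> ev w = g" _ length] by blast
  have d: "distinct (refls w)"
    using X w(1) by (rule distinct_refls_shortest) (use short w in auto)
  have "w \<in> lists I" using w X lists_mono by blast
  then have "Inv g = set (refls w)"
    using w d by (auto simp: Inv_ev odd_count_distinct)
  with that w d show ?thesis by blast
qed

text \<open>A shortest word has as many letters as its element has inversions, here one.\<close>

lemma simple_of_Inv_single:
  assumes X: "X \<subseteq> I" and g: "g \<in> par X" and "Inv g = {t}"
  obtains q where "q \<in> X" "g = s q"
proof -
  obtain w where w: "w \<in> lists X" "g = ev w" "distinct (refls w)" "Inv g = set (refls w)"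
    using X g by (rule distinct_wordE)
  then have "length w = 1"
    using distinct_card[of "refls w"] assms(3) by simp
  then obtain q where "w = [q]" by (cases w) auto
  with w X that[of q] show ?thesis by auto
qed

text \<open>These are the representatives of minimal length of the cosets of \<open>par X\<close>.\<close>

definition reduced :: "'i set \<Rightarrow> 'a \<Rightarrow> bool" where
  "reduced X u \<longleftrightarrow> u \<in> carrier G \<and> Inv u \<inter> par X = {}"

lemma reduced_closed [simp]: "reduced X u \<Longrightarrow> u \<in> carrier G"
  by (simp add: reduced_def)

text \<open>With \<open>r = u s\<^sub>i u\<inverse>\<close>, both sides of \<open>u s\<^sub>i = r u\<close> have an inversion set computed by the cocycle
  identity. Within \<open>par X\<close> the contributions of \<open>u\<close> vanish, which leaves \<open>{r}\<close> on the left and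
  \<open>Inv r\<close> on the right.\<close>

lemma reduced_conj_simple:
  assumes X: "X \<subseteq> I" and u: "reduced X u" and i: "i \<in> I" and r: "conj_by u (s i) \<in> par X"
  obtains q where "q \<in> X" "conj_by u (s i) = s q"
proof -
  let ?r = "conj_by u (s i)"
  have c: "u \<in> carrier G" "?r \<in> carrier G" using u i by auto
  have "t \<in> Inv ?r \<longleftrightarrow> t = ?r" if t: "t \<in> par X" for t
  proof -
    have tc: "t \<in> carrier G" using X t by (rule par_closed)
    have "t \<in> Inv (?r \<otimes> u) \<longleftrightarrow> t \<in> Inv ?r"
      using Inv_mult[OF c(2,1) tc] par_conj[OF X par_inv[OF X r] t] u by (auto simp: reduced_def)
    moreover have "t \<in> Inv (u \<otimes> s i) \<longleftrightarrow> conj_by (inv u) t = s i"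
      using Inv_mult[OF c(1) _ tc, of "s i"] u t i by (auto simp: reduced_def)
    moreover have "conj_by (inv u) t = s i \<longleftrightarrow> t = ?r"
      using c tc i by (simp add: conj_by_inv_eq_iff)
    ultimately show ?thesis using mult_conj_by[of u "s i"] c i by simp
  qed
  then have "Inv ?r = {?r}" using Inv_par[OF X r] r by blast
  with X r show ?thesis using that by (rule simple_of_Inv_single)
qed

text \<open>Multiplying by \<open>s i\<close> changes the inversion set only at \<open>conj_by u (s i)\<close>.\<close>

lemma reduced_step:
  assumes X: "X \<subseteq> I" and u: "reduced X u" and i: "i \<in> I" and r: "conj_by u (s i) \<notin> par X"
  shows "reduced X (u \<otimes> s i)"
proof -
  have "t \<notin> Inv (u \<otimes> s i)" if t: "t \<in> par X" for t
  proof -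
    have tc: "t \<in> carrier G" using X t by (rule par_closed)
    have "conj_by (inv u) t \<noteq> s i" using r t tc u i by (auto simp: conj_by_inv_eq_iff)
    then show ?thesis using Inv_mult[of u "s i" t] u t tc i by (auto simp: reduced_def)
  qed
  with u i show ?thesis by (auto simp: reduced_def)
qed


section \<open>The transducer on signed words\<close>

text \<open>Read only at elements \<open>t\<close> that are generators from \<open>X\<close>.\<close>

definition letter :: "'i set \<Rightarrow> 'a \<Rightarrow> 'i" where
  "letter X t = (THE q. q \<in> X \<and> s q = t)"

lemma s_eq_iff [simp]: "i \<in> I \<Longrightarrow> j \<in> I \<Longrightarrow> s i = s j \<longleftrightarrow> i = j"
  using s_indep[of "{j}" i] s_in_par[of j "{j}"] by auto

lemma letter_s [simp]: "X \<subseteq> I \<Longrightarrow> q \<in> X \<Longrightarrow> letter X (s q) = q"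
  unfolding letter_def by (rule the_equality) (auto simp: subset_iff)

text \<open>The state \<open>u\<close> is meant to satisfy \<open>reduced X u\<close>; then the letter that is written exists by
  \<open>reduced_conj_simple\<close>.\<close>

fun run :: "'i set \<Rightarrow> 'a \<Rightarrow> 'i sword \<Rightarrow> 'i sword" where
  "run X u [] = []"
| "run X u ((i, e) # \<omega>) =
    (if conj_by u (s i) \<in> par X then (letter X (conj_by u (s i)), e) # run X u \<omega>
     else run X (u \<otimes> s i) \<omega>)"

abbreviation evs :: "'i sword \<Rightarrow> 'a" where
  "evs \<omega> \<equiv> ev (map fst \<omega>)"

text \<open>The reflection sequence in which each entry carries the sign of its letter.\<close>

fun srefls :: "'i sword \<Rightarrow> ('a \<times> bool) list" where
  "srefls [] = []"
| "srefls ((i, e) # \<omega>) = (s i, e) # map (map_prod (conj_by (s i)) id) (srefls \<omega>)"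

lemma map_fst_srefls: "map fst (srefls \<omega>) = refls (map fst \<omega>)"
proof (induction \<omega> rule: srefls.induct)
  case (2 i e \<omega>)
  have "map fst (map (map_prod (conj_by (s i)) id) (srefls \<omega>)) =
      map (conj_by (s i)) (map fst (srefls \<omega>))"
    by simp
  with 2 show ?case by simp
qed simp

lemma map_snd_srefls: "map snd (srefls \<omega>) = map snd \<omega>"
  by (induction \<omega> rule: srefls.induct) auto

lemma srefls_eq_zip: "srefls \<omega> = zip (refls (map fst \<omega>)) (map snd \<omega>)"
  by (metis map_fst_srefls map_snd_srefls zip_map_fst_snd)

text \<open>The first reflection is the first letter, and conjugating the others by it gives the
  reflections of the remaining word.\<close>

lemma refls_inj: "v \<in> lists I \<Longrightarrow> w \<in> lists I \<Longrightarrow> refls v = refls w \<Longrightarrow> v = w"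
proof (induction v arbitrary: w rule: list.induct)
  case Nil
  then show ?case by (cases w) auto
next
  case (Cons i v)
  then obtain w' where w: "w = i # w'" by (cases w) auto
  have "inj_on (conj_by (s i)) (carrier G)"
    using Cons.prems by (auto simp: inj_on_def conj_by_eq_iff)
  then have "inj_on (conj_by (s i)) (set (refls v) \<union> set (refls w'))"
    by (rule inj_on_subset) (use Cons.prems w in auto)
  then have "refls v = refls w'"
    using Cons.prems w by (auto dest: map_inj_on)
  with Cons w show ?case by auto
qed

lemma srefls_inj:
  assumes "\<omega> \<in> swords I" "\<omega>' \<in> swords I" "srefls \<omega> = srefls \<omega>'"
  shows "\<omega> = \<omega>'"
proof -
  have "map fst \<omega> = map fst \<omega>'"
    using assms by (metis map_fst_srefls map_fst_swords refls_inj)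
  moreover have "map snd \<omega> = map snd \<omega>'"
    using assms by (metis map_snd_srefls)
  ultimately show ?thesis by (metis zip_map_fst_snd)
qed

text \<open>The state in which the transducer stops.\<close>

fun rest :: "'i set \<Rightarrow> 'a \<Rightarrow> 'i sword \<Rightarrow> 'a" where
  "rest X u [] = u"
| "rest X u ((i, e) # \<omega>) =
    (if conj_by u (s i) \<in> par X then rest X u \<omega> else rest X (u \<otimes> s i) \<omega>)"

lemma run_append: "run X u (\<omega> @ \<omega>') = run X u \<omega> @ run X (rest X u \<omega>) \<omega>'"
  by (induction X u \<omega> rule: run.induct) auto

text \<open>The case distinction of the transducer, with all that is known about the current state in each
  case.\<close>

lemma run_induct [consumes 3, case_names Nil out move]:
  assumes X: "X \<subseteq> I" and u: "reduced X u" and \<omega>: "\<omega> \<in> swords I"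
    and nil: "\<And>u. reduced X u \<Longrightarrow> P u []"
    and out: "\<And>u i e \<omega> q. reduced X u \<Longrightarrow> i \<in> I \<Longrightarrow> \<omega> \<in> swords I \<Longrightarrow> q \<in> X \<Longrightarrow>
      conj_by u (s i) = s q \<Longrightarrow> s q \<in> par X \<Longrightarrow> u \<otimes> s i = s q \<otimes> u \<Longrightarrow>
      run X u ((i, e) # \<omega>) = (q, e) # run X u \<omega> \<Longrightarrow> P u \<omega> \<Longrightarrow> P u ((i, e) # \<omega>)"
    and move: "\<And>u i e \<omega>. reduced X u \<Longrightarrow> i \<in> I \<Longrightarrow> \<omega> \<in> swords I \<Longrightarrow>
      conj_by u (s i) \<notin> par X \<Longrightarrow> reduced X (u \<otimes> s i) \<Longrightarrow>
      run X u ((i, e) # \<omega>) = run X (u \<otimes> s i) \<omega> \<Longrightarrow> P (u \<otimes> s i) \<omega> \<Longrightarrow> P u ((i, e) # \<omega>)"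
  shows "P u \<omega>"
  using u \<omega>
proof (induction \<omega> arbitrary: u rule: srefls.induct)
  case 1
  then show ?case by (simp add: nil)
next
  case (2 i e \<omega>)
  then have i: "i \<in> I" and \<omega>: "\<omega> \<in> swords I" by auto
  show ?case
  proof (cases "conj_by u (s i) \<in> par X")
    case True
    then obtain q where q: "q \<in> X" "conj_by u (s i) = s q"
      using reduced_conj_simple X 2(2) i by blast
    moreover have "u \<otimes> s i = s q \<otimes> u"
      using mult_conj_by[of u "s i"] q 2 i by simp
    ultimately show ?thesis using True X i \<omega> 2 by (intro out) auto
  next
    case False
    with reduced_step[OF X 2(2) i] show ?thesis using i \<omega> 2 by (intro move) auto
  qed
qed

lemma run_swords: "X \<subseteq> I \<Longrightarrow> reduced X u \<Longrightarrow> \<omega> \<in> swords I \<Longrightarrow> run X u \<omega> \<in> swords X"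
  by (induction u \<omega> rule: run_induct) auto

lemma run_swords': "X \<subseteq> I \<Longrightarrow> reduced X u \<Longrightarrow> \<omega> \<in> swords I \<Longrightarrow> run X u \<omega> \<in> swords I"
  using run_swords swords_mono by blast

lemma reduced_rest: "X \<subseteq> I \<Longrightarrow> reduced X u \<Longrightarrow> \<omega> \<in> swords I \<Longrightarrow> reduced X (rest X u \<omega>)"
  by (induction u \<omega> rule: run_induct) auto

text \<open>The invariant of the transducer: the decomposition \<open>w = x u\<close> of what has been read into what has
  been written and the state.\<close>

lemma run_rest:
  assumes X: "X \<subseteq> I" and "reduced X u" "\<omega> \<in> swords I"
  shows "evs (run X u \<omega>) \<otimes> rest X u \<omega> = u \<otimes> evs \<omega>"
  using assms
proof (induction u \<omega> rule: run_induct)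
  case (out u i e \<omega> q)
  have q: "q \<in> I" and r: "run X u \<omega> \<in> swords I" "reduced X (rest X u \<omega>)"
    using out X run_swords'[OF X] reduced_rest[OF X] by auto
  have "evs (run X u ((i, e) # \<omega>)) \<otimes> rest X u ((i, e) # \<omega>) =
      s q \<otimes> (evs (run X u \<omega>) \<otimes> rest X u \<omega>)"
    using out(1-4,5,6,8) q r by (simp add: m_assoc)
  also have "\<dots> = (s q \<otimes> u) \<otimes> evs \<omega>"
    using out(1-4,9) q by (simp add: m_assoc)
  also have "\<dots> = u \<otimes> evs ((i, e) # \<omega>)"
    using out(1-3) unfolding out(7)[symmetric] by (simp add: m_assoc)
  finally show ?case .
qed (auto simp: m_assoc)

text \<open>A written letter \<open>q\<close> conjugates the later reflections by an element of \<open>par X\<close>, so it does not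
  change which of them are kept.\<close>

lemma srefls_run:
  assumes X: "X \<subseteq> I" and "reduced X u" "\<omega> \<in> swords I"
  shows "srefls (run X u \<omega>) =
    filter (\<lambda>x. fst x \<in> par X) (map (map_prod (conj_by u) id) (srefls \<omega>))"
  using assms
proof (induction u \<omega> rule: run_induct)
  case (out u i e \<omega> q)
  have q: "q \<in> I" using out X by auto
  have cl: "fst x \<in> carrier G" if "x \<in> set (srefls \<omega>)" for x
    using that refls_closed'[of "map fst \<omega>" "fst x"] out(3)
    by (simp flip: map_fst_srefls)
  have 1: "map_prod (conj_by u) id (map_prod (conj_by (s i)) id x) =
      map_prod (conj_by (s q)) id (map_prod (conj_by u) id x)" if "x \<in> set (srefls \<omega>)" for x
    using cl[OF that] out(1,2,7) q by (cases x) (simp flip: conj_by_mult)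
  have 2: "fst (map_prod (conj_by (s q)) id (map_prod (conj_by u) id x)) \<in> par X \<longleftrightarrow>
      fst (map_prod (conj_by u) id x) \<in> par X" if "x \<in> set (srefls \<omega>)" for x
    using cl[OF that] out(1,6) X by (cases x) (simp add: par_conj_iff)
  let ?c = "\<lambda>g. map_prod (conj_by g) (id :: bool \<Rightarrow> bool)"
  have "filter (\<lambda>x. fst x \<in> par X) (map (?c u) (map (?c (s i)) (srefls \<omega>))) =
      filter (\<lambda>x. fst x \<in> par X) (map (?c (s q)) (map (?c u) (srefls \<omega>)))"
    using 1 by (simp cong: map_cong)
  also have "\<dots> = map (?c (s q)) (filter (\<lambda>x. fst x \<in> par X) (map (?c u) (srefls \<omega>)))"
    using 2 by (simp add: filter_map o_def cong: filter_cong)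
  finally have eq: "map (?c (s q)) (filter (\<lambda>x. fst x \<in> par X) (map (?c u) (srefls \<omega>))) =
      filter (\<lambda>x. fst x \<in> par X) (map (?c u) (map (?c (s i)) (srefls \<omega>)))" ..
  have "srefls (run X u ((i, e) # \<omega>)) =
      (s q, e) # map (?c (s q)) (filter (\<lambda>x. fst x \<in> par X) (map (?c u) (srefls \<omega>)))"
    unfolding out(8) srefls.simps out(9) ..
  also have "\<dots> = filter (\<lambda>x. fst x \<in> par X) (map (?c u) (srefls ((i, e) # \<omega>)))"
    unfolding eq using out(5,6) by simp
  finally show ?case .
next
  case (move u i e \<omega>)
  have cl: "fst x \<in> carrier G" if "x \<in> set (srefls \<omega>)" for x
    using that refls_closed'[of "map fst \<omega>" "fst x"] move(3)
    by (simp flip: map_fst_srefls)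
  have "map_prod (conj_by (u \<otimes> s i)) id x =
      map_prod (conj_by u) id (map_prod (conj_by (s i)) id x)" if "x \<in> set (srefls \<omega>)" for x
    using cl[OF that] move(1,2) by (cases x) (simp add: conj_by_mult)
  then have eq: "map (map_prod (conj_by (u \<otimes> s i)) id) (srefls \<omega>) =
      map (map_prod (conj_by u) id) (map (map_prod (conj_by (s i)) id) (srefls \<omega>))"
    by simp
  have split: "map (map_prod (conj_by u) id) (srefls ((i, e) # \<omega>)) =
      (conj_by u (s i), e) # map (map_prod (conj_by (u \<otimes> s i)) id) (srefls \<omega>)"
    unfolding srefls.simps list.map eq by simp
  show ?case unfolding move(6,7) split using move(4) by simp
qed simp

section \<open>Intersections of parabolic subgroups\<close>

lemma par_induct [consumes 2, case_names one mult]: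
  assumes "g \<in> par X" "X \<subseteq> I" "P \<one>"
    and "\<And>i g. i \<in> X \<Longrightarrow> g \<in> par X \<Longrightarrow> P g \<Longrightarrow> P (s i \<otimes> g)"
  shows "P g"
proof -
  obtain w where "w \<in> lists X" "g = ev w" using assms(1) unfolding par_def by blast
  then show ?thesis
    by (induction w arbitrary: g rule: list.induct) (auto simp: par_def intro: assms(3,4))
qed

text \<open>The hypothesis on \<open>d\<close> says that it is shortest in \<open>d W\<^sub>J\<close>. For \<open>z\<close> in the intersection and
  \<open>r = d z d\<inverse>\<close>, comparing the inversions of \<open>d z = r d\<close> shows that conjugation by \<open>d\<close> carries the
  inversions of \<open>z\<close> to inversions of \<open>r\<close>, hence into \<open>par X\<close>. The first letter of a shortest word for
  \<open>z\<close> is such an inversion. So it lies in the intersection itself, can be removed, and the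
  rest of the word is treated in the same way.\<close>

lemma par_inter_conj:
  assumes X: "X \<subseteq> I" and J: "J \<subseteq> I" and d: "d \<in> carrier G"
    and min: "\<And>y. y \<in> par J \<Longrightarrow> conj_by d y \<notin> Inv d"
    and z: "z \<in> par J" "conj_by d z \<in> par X"
  shows "z \<in> par {k \<in> J. conj_by d (s k) \<in> par X}"
proof -
  have *: "ev w \<in> par {k \<in> J. conj_by d (s k) \<in> par X}"
    if "w \<in> lists J" "distinct (refls w)" "conj_by d (ev w) \<in> par X" for w
    using that
  proof (induction w rule: list.induct)
    case Nil
    have "{k \<in> J. conj_by d (s k) \<in> par X} \<subseteq> I" using J by auto
    then show ?case using subgroup.one_closed[OF subgroup_par] by simp
  next
    case (Cons k w)
    let ?z = "ev (k # w)" and ?r = "conj_by d (ev (k # w))" and ?t = "conj_by d (s k)"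
    have k: "k \<in> J" "k \<in> I" and w: "w \<in> lists J" "w \<in> lists I" "k # w \<in> lists I"
      using Cons.prems J lists_mono[OF J] by auto
    have zJ: "?z \<in> par J" using Cons.prems(1) unfolding par_def by blast
    have c: "?z \<in> carrier G" "?r \<in> carrier G" "?t \<in> carrier G"
      using w(3) k d by (auto simp del: ev.simps)
    \<comment> \<open>Conjugates of elements of \<open>W\<^sub>J\<close> by \<open>d\<close> stay so under \<open>r\<close>, hence are no inversions of \<open>d\<close>.\<close>
    have tr: "conj_by (inv ?r) ?t = conj_by d (conj_by (inv ?z) (s k))"
    proof -
      have "inv ?r \<otimes> d = d \<otimes> inv ?z"
        using c d mult_conj_by[of d ?z]
        by (metis inv_closed inv_solve_left inv_solve_right m_assoc m_closed)
      then show ?thesis using c d k by (simp del: ev.simps flip: conj_by_mult)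
    qed
    have "s k \<in> Inv ?z"
      using Cons.prems(2) w(3) by (simp add: Inv_ev odd_count_distinct del: ev.simps)
    moreover have "?t \<in> Inv (d \<otimes> ?z) \<longleftrightarrow> (?t \<in> Inv d) \<noteq> (s k \<in> Inv ?z)"
      using Inv_mult[OF d c(1,3)] d k by simp
    moreover have "?t \<in> Inv (?r \<otimes> d) \<longleftrightarrow> (?t \<in> Inv ?r) \<noteq> (conj_by (inv ?r) ?t \<in> Inv d)"
      using Inv_mult[OF c(2) d c(3)] .
    moreover have "?t \<notin> Inv d" using min[OF s_in_par] k by simp
    moreover have "conj_by (inv ?r) ?t \<notin> Inv d"
      unfolding tr using min[OF par_conj[OF J par_inv[OF J zJ] s_in_par]] k by simp
    ultimately have "?t \<in> Inv ?r" using mult_conj_by[OF d c(1)] by simp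
    then have t: "?t \<in> par X" using Inv_par[OF X Cons.prems(3)] by blast
    have "?t \<otimes> ?r = conj_by d (ev w)"
      using d k w by (simp flip: conj_by_hom)
    then have "conj_by d (ev w) \<in> par X"
      using par_mult[OF X t Cons.prems(3)] by simp
    moreover have "distinct (refls w)"
      using Cons.prems(2) by (simp add: distinct_map)
    ultimately have "ev w \<in> par {k \<in> J. conj_by d (s k) \<in> par X}"
      using Cons.IH w by blast
    moreover have "s k \<in> par {k \<in> J. conj_by d (s k) \<in> par X}"
      using k t by (intro s_in_par) auto
    ultimately show ?case
      using par_mult[of "{k \<in> J. conj_by d (s k) \<in> par X}"] J by auto
  qed
  obtain w where "w \<in> lists J" "z = ev w" "distinct (refls w)"
    using J z(1) by (rule distinct_wordE)
  with * z(2) show ?thesis by blast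
qed

lemma reduced_one [simp]: "reduced X \<one>"
  by (simp add: reduced_def)

text \<open>Write \<open>u = d y\<inverse>\<close> with \<open>y \<in> W\<^bsub>{i,j}\<^esub>\<close> and \<open>d\<close> shortest in \<open>u W\<^bsub>{i,j}\<^esub>\<close>. The elements of
  \<open>W\<^bsub>{i,j}\<^esub>\<close> that \<open>d\<close> conjugates into \<open>par X\<close> form a parabolic subgroup, generated by none, one or both
  of \<open>s\<^sub>i\<close> and \<open>s\<^sub>j\<close>; passing to \<open>u\<close> conjugates it by \<open>y\<close>. It is all of \<open>W\<^bsub>{i,j}\<^esub>\<close> or has at most one
  element besides the identity.\<close>

lemma dihedral_dichotomy:
  assumes X: "X \<subseteq> I" and u: "u \<in> carrier G" and ij: "i \<in> I" "j \<in> I"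
  obtains "\<And>z. z \<in> par {i, j} \<Longrightarrow> conj_by u z \<in> par X"
  | t where "\<And>z. z \<in> par {i, j} \<Longrightarrow> conj_by u z \<in> par X \<Longrightarrow> z = \<one> \<or> z = t"
proof -
  let ?J = "{i, j}"
  have J: "?J \<subseteq> I" using ij by simp
  obtain w where w: "w \<in> lists I" "inv u = ev w" using u wordE[of "inv u"] by auto
  let ?w = "map (\<lambda>k. (k, True)) w"
  have ws: "?w \<in> swords I" using w by (simp add: swords_iff o_def)
  \<comment> \<open>The transducer over \<open>{i, j}\<close> decomposes \<open>inv u\<close>; inverting yields the shortest element of \<open>u W\<^bsub>{i,j}\<^esub>\<close>.\<close>
  define y d where "y = evs (run ?J \<one> ?w)" and "d = inv (rest ?J \<one> ?w)"
  have yJ: "y \<in> par ?J"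
    using run_swords[OF J reduced_one ws] by (auto simp: y_def par_def)
  have y: "y \<in> carrier G" using J yJ by (rule par_closed)
  have red: "reduced ?J (inv d)" and d: "d \<in> carrier G"
    using reduced_rest[OF J reduced_one ws] by (simp_all add: d_def)
  have "y \<otimes> inv d = inv u"
    using run_rest[OF J reduced_one ws] reduced_rest[OF J reduced_one ws] w
    by (simp add: y_def d_def o_def)
  then have ud: "u = d \<otimes> inv y"
    using y d u by (metis inv_closed inv_inv inv_mult_group)
  have min: "conj_by d z \<notin> Inv d" if "z \<in> par ?J" for z
  proof -
    have z: "z \<in> carrier G" using J that by (rule par_closed)
    have "conj_by d z \<in> Inv d \<longleftrightarrow> z \<in> Inv (inv d)"
      using Inv_inv[of d z] d z by simp
    with red that show ?thesis by (auto simp: reduced_def)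
  qed
  let ?K = "{k \<in> ?J. conj_by d (s k) \<in> par X}"
  have K: "conj_by (inv y) z \<in> par ?K" if "z \<in> par ?J" "conj_by u z \<in> par X" for z
    using that par_inter_conj[OF X J d min, of "conj_by (inv y) z"]
      par_conj[OF J par_inv[OF J yJ] that(1)] ud y d par_closed[OF J that(1)]
    by (simp add: conj_by_mult)
  show ?thesis
  proof (cases "?K = ?J")
    case True
    have all: "conj_by d z \<in> par X" if "z \<in> par ?J" for z
      using that J
    proof (induction z rule: par_induct)
      case one
      then show ?case using d subgroup.one_closed[OF subgroup_par[OF X]] by simp
    next
      case (mult k g)
      then have "conj_by d (s k) \<in> par X" using True by blast
      with mult X J d par_closed[OF J mult(2)] show ?case
        by (auto simp: conj_by_hom par_mult)
    qed
    have "conj_by u z \<in> par X" if "z \<in> par ?J" for z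
      using all[OF par_conj[OF J par_inv[OF J yJ] that]] ud y d par_closed[OF J that]
      by (simp add: conj_by_mult)
    with that(1) show ?thesis by blast
  next
    case False
    then obtain k where k: "k \<in> ?J" "?K \<subseteq> {k}" by blast
    have "g = \<one> \<or> g = s k" if "g \<in> par {k}" for g
    proof -
      have "{k} \<subseteq> I" "k \<in> I" using k(1) J by blast+
      with that show ?thesis by (induction g rule: par_induct) auto
    qed
    then have two: "conj_by (inv y) z = \<one> \<or> conj_by (inv y) z = s k"
      if "z \<in> par ?J" "conj_by u z \<in> par X" for z
      using K[OF that] par_mono[OF k(2)] by blast
    have "z = \<one> \<or> z = conj_by y (s k)"
      if "z \<in> par ?J" "conj_by u z \<in> par X" for z
    proof -
      have "z \<in> carrier G" "k \<in> I" using k(1) J par_closed[OF J that(1)] by auto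
      with two[OF that] y show ?thesis
        by (auto simp: conj_by_inv_eq_iff)
    qed
    with that(2) show ?thesis by blast
  qed
qed

section \<open>The retraction on words\<close>

text \<open>This is the defining property of \<open>\<pi>\<^sup>*\<close>.\<close>

lemma run_in_full:
  assumes X: "X \<subseteq> I" and "\<omega> \<in> swords I"
  shows "srefls (run X \<one> \<omega>) = filter (\<lambda>x. fst x \<in> par X) (srefls \<omega>)"
proof -
  have "map (map_prod (conj_by \<one>) id) (srefls \<omega>) = srefls \<omega>"
  proof (rule map_idI)
    fix x assume "x \<in> set (srefls \<omega>)"
    then have "fst x \<in> carrier G"
      using refls_closed'[of "map fst \<omega>" "fst x"] assms by (simp flip: map_fst_srefls)
    then show "map_prod (conj_by \<one>) id x = x" by (cases x) simp
  qed
  then show ?thesis using srefls_run[OF X reduced_one assms(2)] by simp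
qed

lemma run_unique:
  assumes "X \<subseteq> I" "\<omega> \<in> swords I" "\<omega>' \<in> swords I"
    and "srefls \<omega>' = filter (\<lambda>x. fst x \<in> par X) (srefls \<omega>)"
  shows "run X \<one> \<omega> = \<omega>'"
  using assms run_swords'[OF assms(1) reduced_one] by (intro srefls_inj) (auto simp: run_in_full)

lemma fst_srefls_in_par:
  assumes "X \<subseteq> I" "\<omega> \<in> swords X" "x \<in> set (srefls \<omega>)"
  shows "fst x \<in> par X"
  using refls_in_par[OF assms(1), of "map fst \<omega>"] assms(2,3)
  by (auto simp flip: map_fst_srefls)

lemma run_id:
  assumes "X \<subseteq> I" "\<omega> \<in> swords X"
  shows "run X \<one> \<omega> = \<omega>"
proof (rule run_unique)
  show "\<omega> \<in> swords I" "\<omega> \<in> swords I" using assms swords_mono by blast+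
  show "srefls \<omega> = filter (\<lambda>x. fst x \<in> par X) (srefls \<omega>)"
    using fst_srefls_in_par[OF assms] by (simp add: filter_id_conv)
qed (rule assms)

text \<open>By \<open>run_rest\<close>, a word over \<open>X\<close>, being written unchanged, leaves the state at the identity.\<close>

lemma run_left_mult:
  assumes "X \<subseteq> I" "\<omega> \<in> swords X" "\<omega>' \<in> swords I"
  shows "run X \<one> (\<omega> @ \<omega>') = \<omega> @ run X \<one> \<omega>'"
proof -
  have \<omega>: "\<omega> \<in> swords I" using assms swords_mono by blast
  have "evs \<omega> \<otimes> rest X \<one> \<omega> = evs \<omega> \<otimes> \<one>"
    using run_rest[OF assms(1) reduced_one \<omega>] \<omega> by (simp add: run_id[OF assms(1,2)])
  then have "rest X \<one> \<omega> = \<one>"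
    using reduced_rest[OF assms(1) reduced_one \<omega>] \<omega> by (simp add: left_cancel)
  then show ?thesis by (simp add: run_append run_id[OF assms(1,2)])
qed

text \<open>Both composites, over \<open>X\<close> first or over \<open>Y\<close> first, keep the reflections lying in \<open>W\<^sub>X \<inter> W\<^sub>Y\<close>. Hence
  they are one and the same word, with all letters in \<open>X \<inter> Y\<close>. This also shows that the reflections
  of \<open>\<omega>\<close> in \<open>W\<^sub>X \<inter> W\<^sub>Y\<close> already lie in the subgroup \<open>par (X \<inter> Y)\<close>.\<close>

lemma run_run:
  assumes X: "X \<subseteq> I" and Y: "Y \<subseteq> I" and \<omega>: "\<omega> \<in> swords I"
  shows "run Y \<one> (run X \<one> \<omega>) = run (X \<inter> Y) \<one> \<omega>"
proof -
  let ?v = "run Y \<one> (run X \<one> \<omega>)" and ?v' = "run X \<one> (run Y \<one> \<omega>)"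
  have XI: "run X \<one> \<omega> \<in> swords I" and YI: "run Y \<one> \<omega> \<in> swords I"
    using run_swords' X Y \<omega> reduced_one by blast+
  have v: "srefls ?v = filter (\<lambda>x. fst x \<in> par Y \<and> fst x \<in> par X) (srefls \<omega>)"
    using X Y \<omega> XI by (simp add: run_in_full conj_commute)
  have v': "srefls ?v' = filter (\<lambda>x. fst x \<in> par Y \<and> fst x \<in> par X) (srefls \<omega>)"
    using X Y \<omega> YI by (simp add: run_in_full)
  have sw: "?v \<in> swords Y" "?v' \<in> swords X"
    using run_swords X Y XI YI reduced_one by blast+
  have "?v = ?v'"
    using v v' sw swords_mono[OF X] swords_mono[OF Y] by (intro srefls_inj) auto
  with sw have vXY: "?v \<in> swords (X \<inter> Y)" by (auto simp: swords_def in_lists_conv_set)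
  have "fst x \<in> par (X \<inter> Y)" if "x \<in> set (srefls \<omega>)" "fst x \<in> par Y" "fst x \<in> par X" for x
    using fst_srefls_in_par[OF _ vXY, of x] that X v by auto
  moreover have "par (X \<inter> Y) \<subseteq> par X" "par (X \<inter> Y) \<subseteq> par Y" by (auto intro!: par_mono)
  ultimately have "srefls ?v = filter (\<lambda>x. fst x \<in> par (X \<inter> Y)) (srefls \<omega>)"
    unfolding v by (intro filter_cong) auto
  then show ?thesis
    using X \<omega> sw(1) swords_mono[OF Y] by (intro run_unique[symmetric]) auto
qed

end

section \<open>Relations and full subgraphs\<close>

lemma pres_rel_mono:
  assumes "(u, v) \<in> pres_rel S R" "S \<subseteq> S'" "R \<subseteq> R'"
  shows "(u, v) \<in> pres_rel S' R'"
  using assms(1)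
proof induction
  case (pres_relator u v)
  moreover have "lists (S \<times> UNIV) \<subseteq> lists (S' \<times> UNIV)"
    using assms(2) by (intro lists_mono) auto
  ultimately show ?case using assms(3) by (intro pres_rel.pres_relator) (auto simp: swords_def)
next
  case (pres_refl u)
  moreover have "lists (S \<times> UNIV) \<subseteq> lists (S' \<times> UNIV)"
    using assms(2) by (intro lists_mono) auto
  ultimately show ?case by (intro pres_rel.pres_refl) (auto simp: swords_def)
next
  case (pres_trans u v w)
  then show ?case by (meson pres_rel.pres_trans)
qed (use assms in \<open>auto intro: pres_rel.intros\<close>)

lemma braid_relations_full: "braid_relations (full_subgraph \<Gamma> X) \<subseteq> braid_relations \<Gamma>"
  by (auto simp: braid_relations_def full_subgraph_def)

lemma coxeter_relations_full:
  "X \<subseteq> verts \<Gamma> \<Longrightarrow> coxeter_relations (full_subgraph \<Gamma> X) \<subseteq> coxeter_relations \<Gamma>"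
  using braid_relations_full[of \<Gamma> X] by (auto simp: coxeter_relations_def full_subgraph_def)

lemma verts_full [simp]: "verts (full_subgraph \<Gamma> X) = X"
  by (simp add: full_subgraph_def)

lemma pres_rel_incl:
  assumes "u \<in> swords S" "S \<subseteq> S'" "R \<subseteq> R'"
  shows "pres_rel S' R' `` (pres_rel S R `` {u}) = pres_rel S' R' `` {u}"
proof
  show "pres_rel S' R' `` {u} \<subseteq> pres_rel S' R' `` (pres_rel S R `` {u})"
    using pres_refl[OF assms(1), of R] by blast
  show "pres_rel S' R' `` (pres_rel S R `` {u}) \<subseteq> pres_rel S' R' `` {u}"
    using pres_rel_mono[OF _ assms(2,3)] by (blast intro: pres_trans)
qed

lemma carrier_artin: "carrier (artin_group \<Gamma>) = artin_class \<Gamma> ` swords (verts \<Gamma>)"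
  by (auto simp: artin_group_def artin_class_def presented_group_def quotient_def)

lemma artin_class_mult:
  "u \<in> swords (verts \<Gamma>) \<Longrightarrow> v \<in> swords (verts \<Gamma>) \<Longrightarrow>
    artin_class \<Gamma> u \<otimes>\<^bsub>artin_group \<Gamma>\<^esub> artin_class \<Gamma> v = artin_class \<Gamma> (u @ v)"
  by (simp add: artin_group_def artin_class_def presented_group_mult)

lemma artin_incl_class:
  "\<omega> \<in> swords X \<Longrightarrow> X \<subseteq> verts \<Gamma> \<Longrightarrow>
    artin_incl \<Gamma> (artin_class (full_subgraph \<Gamma> X) \<omega>) = artin_class \<Gamma> \<omega>"
  using braid_relations_full[of \<Gamma> X]
  by (simp add: artin_incl_def artin_class_def pres_rel_incl)

lemma full_subgraph_trans:
  "X \<subseteq> Y \<Longrightarrow> full_subgraph (full_subgraph \<Gamma> Y) X = full_subgraph \<Gamma> X"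
  by (auto simp: full_subgraph_def)

lemma labelled_simplicial_full:
  "labelled_simplicial_graph \<Gamma> \<Longrightarrow> Y \<subseteq> verts \<Gamma> \<Longrightarrow> labelled_simplicial_graph (full_subgraph \<Gamma> Y)"
  by (auto simp: labelled_simplicial_graph_def full_subgraph_def intro: finite_subset)

text \<open>Beyond the relations themselves, \<open>order\<close> says that the labels are the exact orders of the products
  of two generators, and that the order is infinite where there is no edge.\<close>

locale coxeter_system = reflection_system G I s
  for G (structure) and I :: "'i set" and s +
  fixes \<Gamma> :: "'i lgraph"
  assumes graph: "labelled_simplicial_graph \<Gamma>"
    and verts: "I = verts \<Gamma>"
    and order: "i \<in> I \<Longrightarrow> j \<in> I \<Longrightarrow> i \<noteq> j \<Longrightarrow>
      (s i \<otimes> s j) [^] (n :: nat) = \<one> \<longleftrightarrow> n = 0 \<or> {i, j} \<in> edges \<Gamma> \<and> label \<Gamma> {i, j} dvd n"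
begin

lemma edgeD:
  assumes "{i, j} \<in> edges \<Gamma>"
  shows "i \<in> I" "j \<in> I" "i \<noteq> j" "2 \<le> label \<Gamma> {i, j}"
proof -
  have *: "{i, j} \<subseteq> verts \<Gamma>" "card {i, j} = 2" "2 \<le> label \<Gamma> {i, j}"
    using graph assms unfolding labelled_simplicial_graph_def by blast+
  then show "i \<in> I" "j \<in> I" "2 \<le> label \<Gamma> {i, j}" using verts by auto
  show "i \<noteq> j" using *(2) by auto
qed

lemma braid_pow:
  assumes "{i, j} \<in> edges \<Gamma>"
  shows "(s i \<otimes> s j) [^] label \<Gamma> {i, j} = \<one>"
  using assms edgeD[OF assms] order[of i j "label \<Gamma> {i, j}"] by simp

lemma evs_alternating: "evs (alternating n i j) = ev (alt n i j)"
  by (simp add: alternating_eq_alt o_def)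

lemma evs_pres_rel:
  assumes "(\<omega>, \<omega>') \<in> pres_rel Y R" "Y \<subseteq> I" "R \<subseteq> coxeter_relations \<Gamma>"
  shows "evs \<omega> = evs \<omega>'"
  using assms(1)
proof induction
  case (pres_relator u v)
  then have "(u, v) \<in> coxeter_relations \<Gamma>" using assms(3) by blast
  then show ?case
  proof (auto simp: coxeter_relations_def braid_relations_def evs_alternating verts[symmetric])
    fix i j assume e: "{i, j} \<in> edges \<Gamma>"
    show "ev (alt (label \<Gamma> {i, j}) i j) = ev (alt (label \<Gamma> {i, j}) j i)"
      using braid_pow[OF e] edgeD[OF e] by (simp add: ev_alt_eq_iff)
  qed
next
  case (pres_append u u' v v')
  then have "w \<in> swords I" if "w \<in> {u, u', v, v'}" for w
    using that pres_rel_swords swords_mono[OF assms(2)] by blast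
  with pres_append show ?case by (simp add: ev_append)
qed (use assms(2) in \<open>auto simp: subset_iff\<close>)

text \<open>The label is recovered from the order of the product, which conjugation preserves.\<close>

lemma edge_transport:
  assumes e: "{i, j} \<in> edges \<Gamma>" and u: "u \<in> carrier G" and q: "q \<in> I" "q' \<in> I"
    and c: "conj_by u (s i) = s q" "conj_by u (s j) = s q'"
  shows "{q, q'} \<in> edges \<Gamma>" "label \<Gamma> {q, q'} = label \<Gamma> {i, j}"
proof -
  note ij = edgeD[OF e]
  have "q \<noteq> q'" using c u ij conj_by_eq_iff[of u "s i" "s j"] by auto
  have "(s q \<otimes> s q') [^] n = conj_by u ((s i \<otimes> s j) [^] n)" for n :: nat
    using u ij by (simp add: conj_by_pow conj_by_hom c)
  then have "(s q \<otimes> s q') [^] n = \<one> \<longleftrightarrow> (s i \<otimes> s j) [^] n = \<one>" for n :: nat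
    using u ij conj_by_eq_iff[of u "(s i \<otimes> s j) [^] n" \<one>] by simp
  then have "n = 0 \<or> {q, q'} \<in> edges \<Gamma> \<and> label \<Gamma> {q, q'} dvd n \<longleftrightarrow>
      n = 0 \<or> label \<Gamma> {i, j} dvd n" for n
    using order[OF q \<open>q \<noteq> q'\<close>] order[OF ij(1-3)] e by simp
  from this[of "label \<Gamma> {i, j}"] this[of "label \<Gamma> {q, q'}"] ij(4)
  show *: "{q, q'} \<in> edges \<Gamma>" and "label \<Gamma> {q, q'} = label \<Gamma> {i, j}"
    using edgeD(4)[of q q'] by (auto intro: dvd_antisym)
qed

lemma distinct_refls_alt:
  assumes e: "{i, j} \<in> edges \<Gamma>"
  shows "distinct (refls (alt (label \<Gamma> {i, j}) i j))"
proof -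
  let ?p = "s i \<otimes> s j" and ?m = "label \<Gamma> {i, j}"
  note ij = edgeD[OF e]
  have p: "?p \<in> carrier G" using ij by simp
  have ne: "?p [^] k \<noteq> ?p [^] l" if "k < l" "l < ?m" for k l
  proof
    assume eq: "?p [^] k = ?p [^] l"
    have "?p [^] k \<otimes> ?p [^] (l - k) = ?p [^] l"
      using that p by (simp add: nat_pow_mult)
    then have "?p [^] k \<otimes> ?p [^] (l - k) = ?p [^] k \<otimes> \<one>"
      using p eq by simp
    then have "?p [^] (l - k) = \<one>"
      using p by (simp add: p)
    then have "?m dvd l - k" using order[OF ij(1-3), of "l - k"] that by simp
    with that show False by (auto dest: dvd_imp_le)
  qed
  have "inj_on (\<lambda>k. ?p [^] k \<otimes> s i) {0..<?m}"
  proof (rule inj_onI)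
    fix k l assume "k \<in> {0..<?m}" "l \<in> {0..<?m}" "?p [^] k \<otimes> s i = ?p [^] l \<otimes> s i"
    then show "k = l"
      using ne[of k l] ne[of l k] p ij by (metis atLeastLessThan_iff linorder_neqE_nat nat_pow_closed right_cancel s_closed)
  qed
  then show ?thesis using ij by (simp add: refls_alt distinct_map)
qed

lemma srefls_alternating:
  "srefls (alternating n i j) = map (\<lambda>t. (t, True)) (refls (alt n i j))"
proof -
  have "map snd (alternating n i j) = replicate (length (refls (alt n i j))) True"
    by (simp add: alternating_eq_alt o_def map_replicate_const)
  then show ?thesis
    by (simp add: srefls_eq_zip alternating_eq_alt o_def zip_replicate2 map_replicate_const)
qed

lemma run_alternating:
  assumes X: "X \<subseteq> I" and q: "q \<in> X" "q' \<in> X"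
    and c: "conj_by u (s i) = s q" "conj_by u (s j) = s q'"
  shows "run X u (alternating n i j) = alternating n q q'"
  unfolding alternating_eq_alt using q c
proof (induction n arbitrary: i j q q')
  case (Suc n)
  then have "s q \<in> par X" using X s_in_par by blast
  with Suc X show ?case by simp
qed simp

text \<open>If the state \<open>u\<close> conjugates all of \<open>W\<^bsub>{i,j}\<^esub>\<close> into \<open>par X\<close>, it never changes and the letters \<open>q\<close> and
  \<open>q'\<close> into which \<open>i\<close> and \<open>j\<close> are translated satisfy a braid relation of the same length. Otherwise at
  most one reflection is kept; it occurs once on each side because the reflections along one
  side are distinct, and a word is determined by its signed reflections.\<close>

lemma run_braid:
  assumes X: "X \<subseteq> I" and u: "reduced X u" and e: "{i, j} \<in> edges \<Gamma>"
  defines "m \<equiv> label \<Gamma> {i, j}"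
  shows "run X u (alternating m i j) = run X u (alternating m j i) \<or>
    (run X u (alternating m i j), run X u (alternating m j i)) \<in>
      braid_relations (full_subgraph \<Gamma> X)"
proof -
  note ij = edgeD[OF e]
  have uc: "u \<in> carrier G" using u by simp
  show ?thesis
  proof (rule dihedral_dichotomy[OF X uc ij(1,2)])
    assume all: "\<And>z. z \<in> par {i, j} \<Longrightarrow> conj_by u z \<in> par X"
    have "conj_by u (s i) \<in> par X" "conj_by u (s j) \<in> par X"
      using all s_in_par ij by auto
    then obtain q q' where q: "q \<in> X" "conj_by u (s i) = s q"
      and q': "q' \<in> X" "conj_by u (s j) = s q'"
      using reduced_conj_simple[OF X u] ij by metis
    have "{q, q'} \<in> edges \<Gamma>" "label \<Gamma> {q, q'} = m"
      using edge_transport[OF e uc _ _ q(2) q'(2)] X q(1) q'(1) by (auto simp: m_def)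
    then have "(alternating m q q', alternating m q' q) \<in> braid_relations (full_subgraph \<Gamma> X)"
      unfolding braid_relations_def using q(1) q'(1)
      by (simp add: full_subgraph_def, blast)
    then show ?thesis using run_alternating X q q' by simp
  next
    fix t assume t: "\<And>z. z \<in> par {i, j} \<Longrightarrow> conj_by u z \<in> par X \<Longrightarrow> z = \<one> \<or> z = t"
    let ?f = "\<lambda>x. fst (map_prod (conj_by u) (id :: bool \<Rightarrow> bool) x) \<in> par X"
    let ?L = "refls (alt m i j)"
    have sr: "srefls (run X u (alternating m i j)) =
        map (map_prod (conj_by u) id) (filter ?f (srefls (alternating m i j)))"
      if "i \<in> I" "j \<in> I" for i j
      using srefls_run[OF X u, of "alternating m i j"] that by (simp add: filter_map o_def)
    have "z \<noteq> \<one>" if "z \<in> set ?L" for z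
    proof
      assume "z = \<one>"
      then have "\<exists>a k b. alt m i j = a @ k # b \<and> \<one> = conj_by (ev a) (s k)"
        using that ij by (intro refls_split) auto
      then obtain a k b where a: "alt m i j = a @ k # b" "\<one> = conj_by (ev a) (s k)"
        by blast
      then have "a \<in> lists I" "k \<in> I"
        using alt_lists[OF ij(1,2), of m] by auto
      then have "s k = \<one>"
        using conj_by_eq_iff[of "ev a" \<one> "s k"] a(2)[symmetric] by simp
      then show False
        using s_indep[of "{}" k] \<open>k \<in> I\<close> subgroup.one_closed[OF subgroup_par[of "{}"]] by auto
    qed
    moreover have "set ?L \<subseteq> par {i, j}"
      by (rule refls_in_par) (use ij in auto)
    ultimately have "set (filter ?f (srefls (alternating m i j))) \<subseteq> {(t, True)}"
      using t by (fastforce simp: srefls_alternating)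
    moreover have "distinct (filter ?f (srefls (alternating m i j)))"
      using distinct_refls_alt[OF e] by (simp add: srefls_alternating distinct_map inj_on_def m_def)
    ultimately have len: "length (filter ?f (srefls (alternating m i j))) \<le> 1"
      using card_mono[of "{(t, True)}" "set (filter ?f (srefls (alternating m i j)))"]
        distinct_card[of "filter ?f (srefls (alternating m i j))"]
      by (simp del: set_filter)
    have "srefls (alternating m j i) = rev (srefls (alternating m i j))"
      using refls_alt_rev[OF ij(1,2) braid_pow[OF e]]
      by (simp add: srefls_alternating rev_map m_def)
    then have "filter ?f (srefls (alternating m j i)) = filter ?f (srefls (alternating m i j))"
      using len by (cases "filter ?f (srefls (alternating m i j))") (auto simp flip: rev_filter)
    then have "run X u (alternating m i j) = run X u (alternating m j i)"
      using ij run_swords'[OF X u] by (intro srefls_inj) (auto simp: sr)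
    then show ?thesis ..
  qed
qed

text \<open>The statement covers all states, since a relation applied in the middle of a word meets the
  transducer in an arbitrary one. For products of relations the two halves must leave it in the
  same state, which follows from \<open>run_rest\<close> because equivalent words spell the same element of \<open>W\<close>.
  The version for Coxeter relations is what proves that \<open>W\<^sub>X\<close> embeds in \<open>W\<^sub>I\<close>.\<close>

lemma run_pres_rel:
  assumes X: "X \<subseteq> I"
    and R: "R = braid_relations \<Gamma> \<and> R' = braid_relations (full_subgraph \<Gamma> X) \<or>
      R = coxeter_relations \<Gamma> \<and> R' = coxeter_relations (full_subgraph \<Gamma> X)"
    and rel: "(\<omega>, \<omega>') \<in> pres_rel I R" and u: "reduced X u"
  shows "(run X u \<omega>, run X u \<omega>') \<in> pres_rel X R'"
proof -
  have RI: "R \<subseteq> coxeter_relations \<Gamma>" and R'I: "R' \<subseteq> coxeter_relations \<Gamma>"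
    and braidR': "braid_relations (full_subgraph \<Gamma> X) \<subseteq> R'"
    using R braid_relations_full[of \<Gamma> X] coxeter_relations_full[of X \<Gamma>] X verts
    by (auto simp: coxeter_relations_def)
  have pair: "run X u [(i, e), (i, e')] = [] \<or>
      (\<exists>q\<in>X. run X u [(i, e), (i, e')] = [(q, e), (q, e')])"
    if u: "reduced X u" and i: "i \<in> I" for u i e e'
  proof (cases "conj_by u (s i) \<in> par X")
    case True
    then obtain q where "q \<in> X" "conj_by u (s i) = s q"
      using reduced_conj_simple[OF X u i] by metis
    with True X show ?thesis by auto
  next
    case False
    then show ?thesis using u i by (simp add: conj_by_mult)
  qed
  show ?thesis using rel u
  proof (induction arbitrary: u)
    case (pres_refl w)
    then show ?case using run_swords[OF X] by (intro pres_rel.pres_refl) auto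
  next
    case (pres_sym v w)
    then show ?case by (blast intro: pres_rel.pres_sym)
  next
    case (pres_trans v w x)
    then show ?case by (blast intro: pres_rel.pres_trans)
  next
    case (pres_cancel i e)
    have "([], []) \<in> pres_rel X R'" by (rule pres_rel.pres_refl) simp
    then show ?case
      using pair[OF pres_cancel(2,1), of e "\<not> e"]
      by (auto intro: pres_rel.pres_cancel simp del: run.simps(2))
  next
    case (pres_relator v w)
    have sw: "run X u v \<in> swords X" "run X u w \<in> swords X"
      using run_swords[OF X] pres_relator by auto
    have "run X u v = run X u w \<or> (run X u v, run X u w) \<in> R'"
    proof (cases "(v, w) \<in> braid_relations \<Gamma>")
      case True
      then show ?thesis
        using run_braid[OF X pres_relator(4)] braidR' unfolding braid_relations_def[of \<Gamma>] by blast
    next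
      case False
      then obtain i where i: "i \<in> I" "v = [(i, True), (i, True)]" "w = []"
        and R': "R' = coxeter_relations (full_subgraph \<Gamma> X)"
        using pres_relator(1) R verts by (auto simp: coxeter_relations_def)
      show ?thesis
        using pair[OF pres_relator(4) i(1), of True True] i R'
        by (auto simp: coxeter_relations_def simp del: run.simps(2))
    qed
    then show ?case using sw by (auto intro: pres_rel.pres_relator pres_rel.pres_refl)
  next
    case (pres_append v v' w w')
    have sw: "v \<in> swords I" "v' \<in> swords I"
      using pres_append(1) pres_rel_swords by blast+
    have vv: "(run X u v, run X u v') \<in> pres_rel X R'" using pres_append by blast
    have "evs (run X u v) = evs (run X u v')"
      using evs_pres_rel[OF vv X R'I] .
    moreover have "evs v = evs v'"
      using evs_pres_rel[OF pres_append(1) subset_refl RI] .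
    ultimately have "evs (run X u v) \<otimes> rest X u v = evs (run X u v) \<otimes> rest X u v'"
      using run_rest[OF X pres_append(5)] sw by metis
    moreover have "run X u v \<in> swords I" "reduced X (rest X u v)" "reduced X (rest X u v')"
      using run_swords'[OF X pres_append(5)] reduced_rest[OF X pres_append(5)] sw by auto
    ultimately have "rest X u v = rest X u v'"
      by (simp add: left_cancel)
    then show ?case
      unfolding run_append using vv pres_append.IH(2)[OF reduced_rest[OF X pres_append(5) sw(1)]]
      by (auto intro: pres_rel.pres_append)
  qed
qed

end

section \<open>The reflection representation\<close>

text \<open>The Chebyshev polynomials of the second kind, rescaled and shifted: at \<open>c = 2 cos x\<close> the value is
  \<open>sin (n x) / sin x\<close>, and at \<open>c = 2\<close> it is \<open>n\<close>.\<close>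

fun cheb :: "real \<Rightarrow> nat \<Rightarrow> real" where
  "cheb c 0 = 0"
| "cheb c (Suc 0) = 1"
| "cheb c (Suc (Suc n)) = c * cheb c (Suc n) - cheb c n"

lemma cheb_invariant: "(cheb c (Suc n))\<^sup>2 - c * cheb c (Suc n) * cheb c n + (cheb c n)\<^sup>2 = 1"
proof (induction n)
  case (Suc n)
  then show ?case by (simp add: power2_eq_square algebra_simps)
qed simp

lemma cheb_cos: "cheb (2 * cos x) n * sin x = sin (real n * x)"
proof (induction n rule: induct_nat_012)
  case (ge2 n)
  have "real (Suc (Suc n)) * x = real (Suc n) * x + x" "real n * x = real (Suc n) * x - x"
    by (simp_all add: algebra_simps)
  then have "sin (real (Suc (Suc n)) * x) + sin (real n * x) = 2 * cos x * sin (real (Suc n) * x)"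
    by (simp only: sin_add sin_diff) simp
  with ge2 show ?case by (simp add: algebra_simps)
qed simp_all

lemma cheb_two: "cheb 2 n = real n"
  by (induction n rule: induct_nat_012) simp_all

lemma cheb_label_eq_0_iff:
  assumes "m \<ge> 2"
  shows "cheb (2 * cos (pi / real m)) n = 0 \<longleftrightarrow> m dvd n"
proof -
  have "sin (pi / real m) > 0"
    using assms by (intro sin_gt_zero) (auto simp: field_simps)
  then have "cheb (2 * cos (pi / real m)) n = 0 \<longleftrightarrow> sin (real n * (pi / real m)) = 0"
    using cheb_cos[of "pi / real m" n] by (metis less_irrefl mult_eq_0_iff)
  also have "\<dots> \<longleftrightarrow> (\<exists>k::int. real n * (pi / real m) = of_int k * pi)"
    by (rule sin_zero_iff_int2)
  also have "\<dots> \<longleftrightarrow> (\<exists>k::int. real n = of_int k * real m)"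
    using assms by (simp add: field_simps)
  also have "\<dots> \<longleftrightarrow> (\<exists>k::int. int n = k * int m)"
    by (metis of_int_eq_iff of_int_mult of_int_of_nat_eq)
  also have "\<dots> \<longleftrightarrow> int m dvd int n"
    by (auto simp: dvd_def mult.commute)
  finally show ?thesis by simp
qed

text \<open>The negative of twice the Gram matrix of the geometric representation; the entry 2 for a pair
  without an edge makes the product of the two reflections of infinite order.\<close>

definition cmat :: "'a lgraph \<Rightarrow> 'a \<Rightarrow> 'a \<Rightarrow> real" where
  "cmat \<Gamma> i k = (if i = k then - 2
    else if {i, k} \<in> edges \<Gamma> then 2 * cos (pi / real (label \<Gamma> {i, k})) else 2)"

text \<open>The contragredient of the geometric representation, in coordinates with respect to the dual
  basis.\<close>

definition reflect :: "'a lgraph \<Rightarrow> 'a \<Rightarrow> ('a \<Rightarrow> real) \<Rightarrow> ('a \<Rightarrow> real)" where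
  "reflect \<Gamma> i f = (\<lambda>k. f k + cmat \<Gamma> i k * f i)"

lemma cmat_sym: "cmat \<Gamma> i j = cmat \<Gamma> j i"
  by (simp add: cmat_def insert_commute)

lemma reflect_reflect [simp]: "reflect \<Gamma> i (reflect \<Gamma> i f) = f"
  by (simp add: reflect_def cmat_def fun_eq_iff)

abbreviation act :: "'a lgraph \<Rightarrow> 'a list \<Rightarrow> ('a \<Rightarrow> real) \<Rightarrow> ('a \<Rightarrow> real)" where
  "act \<Gamma> \<equiv> fold (reflect \<Gamma>)"

lemma act_rev: "act \<Gamma> (rev w) (act \<Gamma> w f) = f"
  by (induction w arbitrary: f) auto

text \<open>The powers of the product of two reflections in closed form. Every correction term carries the factor
  \<open>cheb c n\<close>, so the power is trivial as soon as that value vanishes.\<close>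

lemma act_alt:
  fixes \<Gamma> :: "'a lgraph"
  assumes "i \<noteq> j"
  defines "c \<equiv> cmat \<Gamma> i j"
  shows "act \<Gamma> (alt (2 * n) i j) f k = f k
    + cmat \<Gamma> i k * ((cheb c n)\<^sup>2 * f i + cheb c n * (c * cheb c n - cheb c (Suc n)) * f j)
    + cmat \<Gamma> j k * (cheb c n * cheb c (Suc n) * f i + (cheb c n)\<^sup>2 * f j)"
proof (induction n arbitrary: f)
  case (Suc n)
  define A B x y p q where "A = cheb c n" and "B = cheb c (Suc n)" and "x = f i" and "y = f j"
    and "p = cmat \<Gamma> i k" and "q = cmat \<Gamma> j k"
  note ab = A_def[symmetric] B_def[symmetric]
  let ?f = "reflect \<Gamma> j (reflect \<Gamma> i f)"
  \<comment> \<open>The constant terms of the new coefficients are absorbed into squares by this identity.\<close>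
  have rel: "B * B = 1 + c * A * B - A * A"
    using cheb_invariant[of c n] by (simp add: ab power2_eq_square algebra_simps)
  have f: "?f l = f l + cmat \<Gamma> i l * x + cmat \<Gamma> j l * (y + c * x)" for l
    unfolding x_def y_def c_def by (simp add: reflect_def algebra_simps)
  have fi: "?f i = c * y + c * c * x - x" and fj: "?f j = - (y + c * x)"
    unfolding f using assms(1) cmat_sym[of \<Gamma> j i]
    by (simp_all add: x_def y_def c_def cmat_def[of _ i i] cmat_def[of _ j j] algebra_simps)
  have "act \<Gamma> (alt (2 * Suc n) i j) f k = act \<Gamma> (alt (2 * n) i j) ?f k" by simp
  also have "\<dots> = f k + p * x + q * (y + c * x) +
      p * (A * A * (c * y + c * c * x - x) - A * (c * A - B) * (y + c * x)) +
      q * (A * B * (c * y + c * c * x - x) - A * A * (y + c * x))"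
    unfolding Suc.IH fi fj f[of k] ab p_def[symmetric] q_def[symmetric] power2_eq_square
    by (simp add: algebra_simps)
  also have "\<dots> = f k + p * ((1 + c * A * B - A * A) * x + A * B * y) +
      q * ((c * (1 + c * A * B - A * A) - A * B) * x + (1 + c * A * B - A * A) * y)"
    by (simp add: algebra_simps)
  also have "\<dots> = f k + p * (B * B * x + B * (c * B - (c * B - A)) * y) +
      q * (B * (c * B - A) * x + B * B * y)"
    unfolding rel[symmetric] by (simp add: algebra_simps)
  finally show ?case by (simp add: ab x_def y_def p_def q_def power2_eq_square)
qed simp

text \<open>Conversely, write \<open>A\<close> and \<open>B\<close> for two consecutive values. Evaluating the closed form at the indicator
  function of \<open>i\<close> gives \<open>c B = 2 A\<close> and \<open>c A = 2 B\<close> unless \<open>A = 0\<close>, which contradicts the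
  quadratic identity \<open>B\<^sup>2 - c A B + A\<^sup>2 = 1\<close>.\<close>

lemma act_alt_eq_id_iff:
  assumes "i \<noteq> j"
  shows "act \<Gamma> (alt (2 * n) i j) = id \<longleftrightarrow> cheb (cmat \<Gamma> i j) n = 0"
proof
  assume "cheb (cmat \<Gamma> i j) n = 0"
  then show "act \<Gamma> (alt (2 * n) i j) = id"
    using act_alt[OF assms, of \<Gamma> n] by (simp add: fun_eq_iff)
next
  define c A B where "c = cmat \<Gamma> i j" and "A = cheb c n" and "B = cheb c (Suc n)"
  let ?f = "(\<lambda>_. 0)(i := 1) :: _ \<Rightarrow> real"
  assume id: "act \<Gamma> (alt (2 * n) i j) = id"
  have "cmat \<Gamma> i i = - 2" "cmat \<Gamma> j j = - 2" "cmat \<Gamma> j i = c"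
    using cmat_sym[of \<Gamma> i j] by (simp_all add: c_def cmat_def)
  then have "A * (c * B) = A * (2 * A)" "A * (c * A) = A * (2 * B)"
    using act_alt[OF assms, of \<Gamma> n ?f i] act_alt[OF assms, of \<Gamma> n ?f j] assms id
    by (simp_all add: A_def B_def power2_eq_square flip: c_def)
  then have "A = 0 \<or> (c * B = 2 * A \<and> c * A = 2 * B)" by auto
  moreover have "B * B - c * B * A + A * A = 1"
    using cheb_invariant[of c n] by (simp add: A_def B_def power2_eq_square)
  moreover have "c * B * A = 2 * (A * A)" "c * B * A = 2 * (B * B)"
    if "c * B = 2 * A" "c * A = 2 * B"
    using that by (simp, metis mult.assoc mult.commute)
  ultimately have "A = 0" by (cases "A = 0") auto
  then show "cheb (cmat \<Gamma> i j) n = 0" by (simp add: A_def c_def)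
qed

lemma cheb_cmat_eq_0_iff:
  assumes "labelled_simplicial_graph \<Gamma>" "i \<noteq> j"
  shows "cheb (cmat \<Gamma> i j) n = 0 \<longleftrightarrow> n = 0 \<or> {i, j} \<in> edges \<Gamma> \<and> label \<Gamma> {i, j} dvd n"
proof (cases "{i, j} \<in> edges \<Gamma>")
  case True
  then have "label \<Gamma> {i, j} \<ge> 2" using assms(1) by (auto simp: labelled_simplicial_graph_def)
  then show ?thesis using True assms(2) by (auto simp: cmat_def cheb_label_eq_0_iff)
qed (use assms(2) in \<open>simp add: cmat_def cheb_two\<close>)

lemma act_pres_rel:
  assumes \<Gamma>: "labelled_simplicial_graph \<Gamma>"
    and "(u, v) \<in> pres_rel S (coxeter_relations \<Gamma>)"
  shows "act \<Gamma> (map fst u) = act \<Gamma> (map fst v)"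
  using assms(2)
proof induction
  case (pres_relator u v)
  have braid: "act \<Gamma> (alt (label \<Gamma> {i, j}) i j) = act \<Gamma> (alt (label \<Gamma> {i, j}) j i)"
    if e: "{i, j} \<in> edges \<Gamma>" for i j
  proof
    fix f
    let ?m = "label \<Gamma> {i, j}"
    have "i \<noteq> j" using \<Gamma> e by (auto simp: labelled_simplicial_graph_def)
    then have "act \<Gamma> (alt (2 * ?m) i j) = id"
      using e by (simp add: act_alt_eq_id_iff cheb_cmat_eq_0_iff[OF \<Gamma>])
    then have "act \<Gamma> (alt (2 * ?m) i j) f = f" by simp
    then have "act \<Gamma> (rev (alt ?m j i)) (act \<Gamma> (alt ?m i j) f) = f"
      by (simp add: alt_double)
    then show "act \<Gamma> (alt ?m i j) f = act \<Gamma> (alt ?m j i) f"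
      using act_rev[of \<Gamma> "rev (alt ?m j i)" "act \<Gamma> (alt ?m i j) f"] by simp
  qed
  from pres_relator(1) show ?case
    by (auto simp: coxeter_relations_def braid_relations_def map_fst_alternating
        intro: braid)
qed auto

section \<open>The Coxeter group of a labelled graph\<close>

locale coxeter_graph =
  fixes \<Gamma> :: "'i lgraph"
  assumes simplicial: "labelled_simplicial_graph \<Gamma>"
begin

abbreviation V where "V \<equiv> verts \<Gamma>"
abbreviation crel where "crel \<equiv> pres_rel V (coxeter_relations \<Gamma>)"
abbreviation pos :: "'i list \<Rightarrow> 'i sword" where "pos w \<equiv> map (\<lambda>i. (i, True)) w"

lemma pos_swords: "w \<in> lists A \<Longrightarrow> pos w \<in> swords A"
  by (simp add: swords_iff o_def)

lemma carrier_coxeter: "carrier (coxeter_group \<Gamma>) = (\<lambda>u. crel `` {u}) ` swords V"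
  by (auto simp: coxeter_group_def presented_group_def quotient_def)

lemma class_mult:
  "u \<in> swords V \<Longrightarrow> v \<in> swords V \<Longrightarrow>
    crel `` {u} \<otimes>\<^bsub>coxeter_group \<Gamma>\<^esub> crel `` {v} = crel `` {u @ v}"
  by (simp add: coxeter_group_def presented_group_mult)

lemma class_one: "\<one>\<^bsub>coxeter_group \<Gamma>\<^esub> = crel `` {[]}"
  by (simp add: coxeter_group_def presented_group_def)

lemma coxeter_class_Nil: "coxeter_class \<Gamma> [] = \<one>\<^bsub>coxeter_group \<Gamma>\<^esub>"
  by (simp add: coxeter_class_def class_one)

lemma coxeter_class_Cons:
  assumes "i \<in> V" "w \<in> lists V"
  shows "coxeter_class \<Gamma> [i] \<otimes>\<^bsub>coxeter_group \<Gamma>\<^esub> coxeter_class \<Gamma> w = coxeter_class \<Gamma> (i # w)"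
  using assms by (simp add: coxeter_class_def class_mult pos_swords)

lemma class_eq_iff:
  "u \<in> swords V \<Longrightarrow> v \<in> swords V \<Longrightarrow> crel `` {u} = crel `` {v} \<longleftrightarrow> (u, v) \<in> crel"
  by (rule eq_equiv_class_iff[OF equiv_pres_rel])

lemma square_rel:
  assumes "i \<in> V"
  shows "([(i, True), (i, True)], []) \<in> crel"
  using assms by (intro pres_relator) (auto simp: coxeter_relations_def)

sublocale involutions "coxeter_group \<Gamma>" V "\<lambda>i. coxeter_class \<Gamma> [i]"
proof (rule involutions.intro)
  show "Group.group (coxeter_group \<Gamma>)"
    unfolding coxeter_group_def by (rule group_presented_group)
  show "involutions_axioms (coxeter_group \<Gamma>) V (\<lambda>i. coxeter_class \<Gamma> [i])"
  proof
    fix i assume i: "i \<in> V"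
    then show "coxeter_class \<Gamma> [i] \<in> carrier (coxeter_group \<Gamma>)"
      by (auto simp: carrier_coxeter coxeter_class_def)
    have "coxeter_class \<Gamma> [i] \<otimes>\<^bsub>coxeter_group \<Gamma>\<^esub> coxeter_class \<Gamma> [i] =
        crel `` {[(i, True), (i, True)]}"
      using i by (simp add: coxeter_class_def class_mult)
    also have "\<dots> = crel `` {[]}"
      using square_rel[OF i] i by (simp add: class_eq_iff)
    finally show "coxeter_class \<Gamma> [i] \<otimes>\<^bsub>coxeter_group \<Gamma>\<^esub> coxeter_class \<Gamma> [i] =
        \<one>\<^bsub>coxeter_group \<Gamma>\<^esub>"
      by (simp add: class_one)
  qed
qed

lemma ev_eq_class: "w \<in> lists V \<Longrightarrow> ev w = coxeter_class \<Gamma> w"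
by (induction w rule: list.induct) (auto simp: coxeter_class_Nil coxeter_class_Cons)

text \<open>In the Coxeter group signs can be dropped, as every generator is its own inverse.\<close>

lemma sword_rel_pos: "u \<in> swords V \<Longrightarrow> (u, pos (map fst u)) \<in> crel"
proof (induction u)
  case Nil
  then show ?case by (auto intro: pres_refl)
next
  case (Cons x u)
  obtain i e where x: "x = (i, e)" by (cases x)
  have i: "i \<in> V" using Cons.prems x by simp
  have refl: "([(i, b)], [(i, b)]) \<in> crel" for b using i by (intro pres_refl) simp
  have "([(i, e)], [(i, True)]) \<in> crel"
  proof (cases e)
    case False
    have "([(i, False)] @ [(i, True), (i, True)], [(i, False)] @ []) \<in> crel"
      using refl square_rel[OF i] by (rule pres_append)
    moreover have "([(i, False), (i, \<not> False)] @ [(i, True)], [] @ [(i, True)]) \<in> crel"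
      using pres_cancel[OF i] refl by (rule pres_append)
    ultimately show ?thesis using False by (auto intro: pres_sym pres_trans)
  qed (use refl in auto)
  from pres_append[OF this Cons.IH] Cons.prems show ?case by (simp add: x)
qed

lemma evs_eq_class:
  assumes "u \<in> swords V"
  shows "ev (map fst u) = crel `` {u}"
proof -
  have "map fst u \<in> lists V" using assms by simp
  then have "ev (map fst u) = crel `` {pos (map fst u)}"
    using ev_eq_class by (simp only: coxeter_class_def[of _ "map fst u"])
  also have "\<dots> = crel `` {u}"
    using equiv_class_eq[OF equiv_pres_rel sword_rel_pos[OF assms]] by simp
  finally show ?thesis .
qed

lemma ev_eq_iff: "v \<in> lists V \<Longrightarrow> w \<in> lists V \<Longrightarrow> ev v = ev w \<longleftrightarrow> (pos v, pos w) \<in> crel"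
  by (simp only: ev_eq_class coxeter_class_def[of _ v] coxeter_class_def[of _ w]
      class_eq_iff pos_swords)

text \<open>The two sides of a braid relation have the same reflections in opposite orders; the other relators
  have one reflection, twice.\<close>

lemma parity_pres_rel:
  assumes "(u, v) \<in> crel" "t \<in> carrier (coxeter_group \<Gamma>)"
  shows "odd (count_list (refls (map fst u)) t) = odd (count_list (refls (map fst v)) t)"
  using assms
proof (induction arbitrary: t)
  case (pres_relator u v)
  have parity_alt: "odd (count_list (refls (alt m i j)) t) = odd (count_list (refls (alt m j i)) t)"
    if ij: "i \<in> V" "j \<in> V" and rel: "(alternating m i j, alternating m j i) \<in> crel" for i j m
  proof -
    have "ev (alt m i j) = ev (alt m j i)"
      using ij rel by (simp add: ev_eq_iff alternating_eq_alt)
    then have "refls (alt m j i) = rev (refls (alt m i j))"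
      using ij by (intro refls_alt_rev) (simp_all add: ev_alt_eq_iff)
    then show ?thesis by simp
  qed
  from pres_relator(1) consider (braid) i j where "{i, j} \<in> edges \<Gamma>"
      "u = alternating (label \<Gamma> {i, j}) i j" "v = alternating (label \<Gamma> {i, j}) j i"
    | (square) i where "u = [(i, True), (i, True)]" "v = []" "i \<in> V"
    by (auto simp: coxeter_relations_def braid_relations_def)
  then show ?case
  proof cases
    case (braid i j)
    then have "{i, j} \<subseteq> V" using simplicial unfolding labelled_simplicial_graph_def by blast
    moreover have "(u, v) \<in> crel" using pres_relator by (intro pres_rel.pres_relator)
    ultimately show ?thesis using braid parity_alt[of i j "label \<Gamma> {i, j}"] by (simp add: map_fst_alternating)
  qed auto
next
  case (pres_append u u' v v')
  have sw: "u \<in> swords V" "u' \<in> swords V" "v \<in> swords V" "v' \<in> swords V"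
    using pres_append(1,2) pres_rel_swords by blast+
  have "ev (map fst u) = ev (map fst u')"
    using sw equiv_class_eq[OF equiv_pres_rel pres_append(1)] by (simp add: evs_eq_class)
  with pres_append sw show ?case
    by (simp add: refls_append count_list_map_conj)
qed auto

text \<open>Independence and orders come from the reflection representation. The indicator function of \<open>i\<close> is
  fixed by every other generator but not by \<open>i\<close>, so the generator of \<open>i\<close> lies in no parabolic subgroup
  that avoids \<open>i\<close>.\<close>

sublocale coxeter_system "coxeter_group \<Gamma>" V "\<lambda>i. coxeter_class \<Gamma> [i]" \<Gamma>
proof
  show "carrier (coxeter_group \<Gamma>) = ev ` lists V"
  proof
    show "ev ` lists V \<subseteq> carrier (coxeter_group \<Gamma>)" by auto
    show "carrier (coxeter_group \<Gamma>) \<subseteq> ev ` lists V"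
      unfolding carrier_coxeter using map_fst_swords by (auto simp flip: evs_eq_class)
  qed
next
  fix u v t assume uv: "u \<in> lists V" "v \<in> lists V" "ev u = ev v"
  show "odd (count_list (refls u) t) = odd (count_list (refls v) t)"
  proof (cases "t \<in> carrier (coxeter_group \<Gamma>)")
    case True
    with parity_pres_rel[of "pos u" "pos v" t] uv show ?thesis by (simp add: ev_eq_iff o_def)
  next
    case False
    then have "t \<notin> set (refls u)" "t \<notin> set (refls v)" using uv refls_closed' by blast+
    then show ?thesis by simp
  qed
next
  fix X i assume X: "X \<subseteq> V" and i: "i \<in> V" "coxeter_class \<Gamma> [i] \<in> par X"
  then obtain w where w: "w \<in> lists X" "coxeter_class \<Gamma> [i] = ev w" unfolding par_def by blast
  have wV: "w \<in> lists V" using w X lists_mono by blast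
  have "ev [i] = ev w" using w i wV by simp
  then have "(pos [i], pos w) \<in> crel" using wV i by (subst (asm) ev_eq_iff) auto
  then have act: "act \<Gamma> [i] = act \<Gamma> w" using act_pres_rel[OF simplicial] by (force simp: o_def)
  show "i \<in> X"
  proof (rule ccontr)
    assume "i \<notin> X"
    define f where "f = (\<lambda>_. 0)(i := 1 :: real)"
    have fixed: "reflect \<Gamma> k f = f" if "k \<in> X" for k
      using that \<open>i \<notin> X\<close> by (auto simp: reflect_def f_def)
    have "act \<Gamma> w f = f"
      using w(1)
    proof (induction w rule: list.induct)
      case (Cons k w)
      then show ?case using fixed[of k] by simp
    qed simp
    then have "act \<Gamma> [i] f i = 1" using act by (simp add: f_def)
    then show False by (simp add: reflect_def cmat_def f_def)
  qed
next
  fix i j n assume ij: "i \<in> V" "j \<in> V" "i \<noteq> j"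
  let ?p = "coxeter_class \<Gamma> [i] \<otimes>\<^bsub>coxeter_group \<Gamma>\<^esub> coxeter_class \<Gamma> [j]"
  have p: "?p [^]\<^bsub>coxeter_group \<Gamma>\<^esub> n = ev (alt (2 * n) i j)"
    using ij by (simp add: alt_double ev_append ev_rev ev_alt_quotient)
  show "?p [^]\<^bsub>coxeter_group \<Gamma>\<^esub> n = \<one>\<^bsub>coxeter_group \<Gamma>\<^esub> \<longleftrightarrow>
      n = 0 \<or> {i, j} \<in> edges \<Gamma> \<and> label \<Gamma> {i, j} dvd n"
  proof
    assume "?p [^]\<^bsub>coxeter_group \<Gamma>\<^esub> n = \<one>\<^bsub>coxeter_group \<Gamma>\<^esub>"
    then have "ev (alt (2 * n) i j) = ev []" using p by simp
    then have "(pos (alt (2 * n) i j), pos []) \<in> crel" using ij by (subst (asm) ev_eq_iff) auto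
    from act_pres_rel[OF simplicial this] have "act \<Gamma> (alt (2 * n) i j) = id"
      by (simp add: o_def)
    then show "n = 0 \<or> {i, j} \<in> edges \<Gamma> \<and> label \<Gamma> {i, j} dvd n"
      using ij simplicial by (simp add: act_alt_eq_id_iff cheb_cmat_eq_0_iff)
  next
    assume "n = 0 \<or> {i, j} \<in> edges \<Gamma> \<and> label \<Gamma> {i, j} dvd n"
    then show "?p [^]\<^bsub>coxeter_group \<Gamma>\<^esub> n = \<one>\<^bsub>coxeter_group \<Gamma>\<^esub>"
    proof
      assume e: "{i, j} \<in> edges \<Gamma> \<and> label \<Gamma> {i, j} dvd n"
      let ?m = "label \<Gamma> {i, j}"
      have "(alternating ?m i j, alternating ?m j i) \<in> crel"
        using e ij by (intro pres_rel.pres_relator)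
          (auto simp: coxeter_relations_def braid_relations_def)
      then have "ev (alt ?m i j) = ev (alt ?m j i)"
        using ij by (simp add: ev_eq_iff alternating_eq_alt)
      then have "?p [^]\<^bsub>coxeter_group \<Gamma>\<^esub> ?m = \<one>\<^bsub>coxeter_group \<Gamma>\<^esub>"
        using ij by (simp add: ev_alt_eq_iff)
      moreover obtain k where "n = ?m * k" using e by blast
      ultimately show ?thesis using ij by (simp flip: nat_pow_pow)
    qed simp
  qed
qed (use simplicial in auto)

end

section \<open>The retraction on the group\<close>

lemma map_nth_filter:
  "map ((!) xs) (filter (\<lambda>j. P (xs ! j)) [0..<length xs]) = filter P xs"
proof -
  have "filter P xs = filter P (map ((!) xs) [0..<length xs])" by (simp only: map_nth)
  then show ?thesis by (simp add: filter_map o_def)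
qed

context coxeter_graph
begin

lemma refl_seq_eq_refls:
  assumes "w \<in> lists V"
  shows "refl_seq \<Gamma> w = refls w"
proof (rule nth_equalityI)
  fix j assume "j < length (refl_seq \<Gamma> w)"
  then have j: "j < length w" by (simp add: refl_seq_def)
  have "w ! j \<in> V" using assms j by (simp add: in_lists_conv_set)
  then have "take j w @ [w ! j] @ rev (take j w) \<in> lists V" using assms by simp
  with j show "refl_seq \<Gamma> w ! j = refls w ! j"
    using assms by (simp add: refl_seq_def refls_nth ev_eq_class)
qed (simp add: refl_seq_def)

lemma coxeter_parabolic_eq_par:
  assumes X: "X \<subseteq> V"
  shows "coxeter_parabolic \<Gamma> X = par X"
proof -
  have incl: "coxeter_incl \<Gamma> (pres_rel X (coxeter_relations (full_subgraph \<Gamma> X)) `` {u}) =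
      ev (map fst u)" if "u \<in> swords X" for u
    using that X swords_mono[OF X that] coxeter_relations_full[OF X]
    by (simp add: coxeter_incl_def pres_rel_incl evs_eq_class)
  have "carrier (coxeter_group (full_subgraph \<Gamma> X)) =
      (\<lambda>u. pres_rel X (coxeter_relations (full_subgraph \<Gamma> X)) `` {u}) ` swords X"
    by (auto simp: coxeter_group_def presented_group_def quotient_def)
  then have "coxeter_parabolic \<Gamma> X = (\<lambda>u. ev (map fst u)) ` swords X"
    by (simp add: coxeter_parabolic_def image_image incl cong: image_cong)
  also have "\<dots> = par X"
    unfolding par_def
  proof
    show "(\<lambda>u. ev (map fst u)) ` swords X \<subseteq> ev ` lists X" by auto
    show "ev ` lists X \<subseteq> (\<lambda>u. ev (map fst u)) ` swords X"
    proof
      fix g assume "g \<in> ev ` lists X"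
      then obtain w where "w \<in> lists X" "g = ev w" by blast
      then show "g \<in> (\<lambda>u. ev (map fst u)) ` swords X"
        by (intro image_eqI[of _ _ "pos w"]) (auto simp: o_def pos_swords)
    qed
  qed
  finally show ?thesis .
qed

abbreviation pi_word :: "'i set \<Rightarrow> 'i sword \<Rightarrow> 'i sword" where
  "pi_word X \<equiv> run X \<one>\<^bsub>coxeter_group \<Gamma>\<^esub>"

lemma retr_word_eq_run:
  assumes X: "X \<subseteq> V" and \<omega>: "\<omega> \<in> swords V"
  shows "retr_word \<Gamma> X \<omega> = pi_word X \<omega>"
proof -
  let ?v = "pi_word X \<omega>" and ?rs = "refls (map fst \<omega>)" and ?ss = "srefls \<omega>"
  let ?js = "filter (\<lambda>j. ?rs ! j \<in> par X) [0..<length \<omega>]"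
  have len: "length ?ss = length \<omega>" by (simp add: srefls_eq_zip)
  have ss: "?ss ! j = (?rs ! j, snd (\<omega> ! j))" if "j < length \<omega>" for j
    using that by (simp add: srefls_eq_zip)
  have js: "?js = filter (\<lambda>j. fst (?ss ! j) \<in> par X) [0..<length ?ss]"
    unfolding len using ss by (intro filter_cong) auto
  have "srefls ?v = map ((!) ?ss) ?js"
    unfolding js using run_in_full[OF X \<omega>] by (simp only: map_nth_filter[of ?ss "\<lambda>x. fst x \<in> par X"])
  also have "\<dots> = map (\<lambda>j. (?rs ! j, snd (\<omega> ! j))) ?js"
    using ss by (intro map_cong) auto
  finally have sv: "srefls ?v = map (\<lambda>j. (?rs ! j, snd (\<omega> ! j))) ?js" .
  have vX: "?v \<in> swords X" using run_swords[OF X reduced_one \<omega>] .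
  have fstv: "refls (map fst ?v) = map (\<lambda>j. ?rs ! j) ?js"
    using sv by (simp flip: map_fst_srefls)
  have sndv: "map snd ?v = map (\<lambda>j. snd (\<omega> ! j)) ?js"
    using sv by (simp flip: map_snd_srefls)
  have L: "v \<in> lists V" if "v \<in> lists X" for v using that X lists_mono by blast
  have the: "(THE v. v \<in> lists X \<and> refl_seq \<Gamma> v = map (\<lambda>j. ?rs ! j) ?js) = map fst ?v"
  proof (rule the_equality)
    show "map fst ?v \<in> lists X \<and> refl_seq \<Gamma> (map fst ?v) = map (\<lambda>j. ?rs ! j) ?js"
      using vX L fstv by (simp add: refl_seq_eq_refls)
    fix v assume "v \<in> lists X \<and> refl_seq \<Gamma> v = map (\<lambda>j. ?rs ! j) ?js"
    then have v: "v \<in> lists V" and "refls v = refls (map fst ?v)"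
      unfolding fstv using L[of v] by (simp_all add: refl_seq_eq_refls)
    then show "v = map fst ?v"
      using L[OF map_fst_swords[OF vX]] by (intro refls_inj)
  qed
  have "retr_word \<Gamma> X \<omega> = zip (map fst ?v) (map snd ?v)"
    unfolding retr_word_def Let_def coxeter_parabolic_eq_par[OF X]
      refl_seq_eq_refls[OF map_fst_swords[OF \<omega>]] the sndv ..
  then show ?thesis by (simp add: zip_map_fst_snd)
qed

text \<open>As \<open>run_pres_rel\<close> makes the class independent of the representative, the description in
  \<open>retr\<close> picks out exactly one element.\<close>

lemma retr_class:
  assumes X: "X \<subseteq> V" and \<omega>: "\<omega> \<in> swords V"
  shows "retr \<Gamma> X (artin_class \<Gamma> \<omega>) = artin_class (full_subgraph \<Gamma> X) (pi_word X \<omega>)"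
proof -
  have eq: "artin_class (full_subgraph \<Gamma> X) (retr_word \<Gamma> X \<omega>') =
      artin_class (full_subgraph \<Gamma> X) (pi_word X \<omega>)" if "\<omega>' \<in> artin_class \<Gamma> \<omega>" for \<omega>'
  proof -
    have rel: "(\<omega>, \<omega>') \<in> pres_rel V (braid_relations \<Gamma>)" using that by (simp add: artin_class_def)
    then have "\<omega>' \<in> swords V" using pres_rel_swords by blast
    moreover have "(pi_word X \<omega>, pi_word X \<omega>') \<in> pres_rel X (braid_relations (full_subgraph \<Gamma> X))"
      using run_pres_rel[OF X _ rel reduced_one] by blast
    from equiv_class_eq[OF equiv_pres_rel this]
    have "artin_class (full_subgraph \<Gamma> X) (pi_word X \<omega>) =
        artin_class (full_subgraph \<Gamma> X) (pi_word X \<omega>')"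
      by (simp add: artin_class_def)
    ultimately show ?thesis by (simp add: retr_word_eq_run[OF X])
  qed
  have "\<omega> \<in> artin_class \<Gamma> \<omega>" using \<omega> by (simp add: artin_class_def pres_refl)
  then show ?thesis
    unfolding retr_def using eq by (intro the_equality) auto
qed

text \<open>Words over \<open>Y\<close> that agree in \<open>W\<^sub>I\<close> are fixed by the retraction onto \<open>Y\<close>, which respects the Coxeter
  relations; so they agree in \<open>W\<^sub>Y\<close>. This embedding carries reflection sequences over \<open>Y\<close> to
  reflection sequences over \<open>I\<close> and respects membership in \<open>W\<^sub>X\<close>, so both maps keep the same
  letters.\<close>

lemma pi_word_subgraph:
  assumes Y: "Y \<subseteq> V" and X: "X \<subseteq> Y" and \<omega>: "\<omega> \<in> swords Y"
  shows "coxeter_graph.pi_word (full_subgraph \<Gamma> Y) X \<omega> = pi_word X \<omega>"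
proof -
  interpret Y: coxeter_graph "full_subgraph \<Gamma> Y"
    by unfold_locales (rule labelled_simplicial_full[OF simplicial Y])
  let ?i = "coxeter_incl \<Gamma>"
  have XV: "X \<subseteq> V" using X Y by blast
  have L: "v \<in> lists V" if "v \<in> lists Y" for v using that Y lists_mono by blast
  have LY: "v \<in> lists Y" if "v \<in> lists X" for v using that X lists_mono by blast
  have incl: "?i (Y.ev w) = ev w" if w: "w \<in> lists Y" for w
    using w L[OF w] Y coxeter_relations_full[OF Y] evs_eq_class[of "pos w"]
      Y.evs_eq_class[of "pos w"]
    by (simp add: coxeter_incl_def pres_rel_incl pos_swords o_def)
  have inj: "Y.ev v = Y.ev w" if vw: "v \<in> lists Y" "w \<in> lists Y" "ev v = ev w" for v w
  proof -
    have "(pos v, pos w) \<in> crel" using vw L by (simp add: ev_eq_iff)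
    then have "(pi_word Y (pos v), pi_word Y (pos w)) \<in>
        pres_rel Y (coxeter_relations (full_subgraph \<Gamma> Y))"
      using run_pres_rel[OF Y _ _ reduced_one] by blast
    then show ?thesis using vw by (simp add: run_id[OF Y] pos_swords Y.ev_eq_iff)
  qed
  have par: "?i t \<in> par X \<longleftrightarrow> t \<in> Y.par X" if t: "t \<in> carrier (coxeter_group (full_subgraph \<Gamma> Y))" for t
  proof -
    obtain z where z: "z \<in> lists Y" "t = Y.ev z" using t Y.wordE[of t] by auto
    have "ev z \<in> par X \<longleftrightarrow> (\<exists>x\<in>lists X. ev z = ev x)" unfolding par_def by blast
    also have "\<dots> \<longleftrightarrow> (\<exists>x\<in>lists X. Y.ev z = Y.ev x)"
      using inj z(1) LY incl by metis
    also have "\<dots> \<longleftrightarrow> t \<in> Y.par X" unfolding Y.par_def z(2) by blast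
    finally show ?thesis using incl z by simp
  qed
  have refls: "map ?i (Y.refls w) = refls w" if w: "w \<in> lists Y" for w
  proof (rule nth_equalityI)
    fix j assume "j < length (map ?i (Y.refls w))"
    then have j: "j < length w" by simp
    have "w ! j \<in> Y" using w j by (simp add: in_lists_conv_set)
    then have "take j w @ [w ! j] @ rev (take j w) \<in> lists Y" using w by simp
    with j w L[OF w] show "map ?i (Y.refls w) ! j = refls w ! j"
      by (simp add: Y.refls_nth refls_nth incl del: append_in_lists_conv append_Cons)
  qed simp
  have srefls: "srefls \<omega>' = map (map_prod ?i id) (Y.srefls \<omega>')" if "\<omega>' \<in> swords Y" for \<omega>'
    using that by (simp add: srefls_eq_zip Y.srefls_eq_zip zip_map1 flip: refls) auto
  let ?v = "Y.pi_word X \<omega>"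
  have vX: "?v \<in> swords X" using Y.run_swords[OF _ Y.reduced_one] X \<omega> by simp
  have "srefls ?v = map (map_prod ?i id) (filter (\<lambda>x. fst x \<in> Y.par X) (Y.srefls \<omega>))"
    using srefls[OF swords_mono[OF X vX]] X \<omega> by (simp add: Y.run_in_full)
  also have "\<dots> = filter (\<lambda>x. fst x \<in> par X) (map (map_prod ?i id) (Y.srefls \<omega>))"
  proof -
    have "fst x \<in> carrier (coxeter_group (full_subgraph \<Gamma> Y))" if "x \<in> set (Y.srefls \<omega>)" for x
      using that Y.refls_closed'[of "map fst \<omega>" "fst x"] \<omega> by (simp flip: Y.map_fst_srefls)
    then have "filter (\<lambda>x. fst x \<in> Y.par X) (Y.srefls \<omega>) =
        filter (\<lambda>x. ?i (fst x) \<in> par X) (Y.srefls \<omega>)"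
      by (intro filter_cong) (simp_all add: par)
    then show ?thesis by (simp add: filter_map o_def)
  qed
  also have "\<dots> = filter (\<lambda>x. fst x \<in> par X) (srefls \<omega>)"
    using srefls[OF \<omega>] by simp
  finally show ?thesis
    using XV swords_mono[OF Y \<omega>] swords_mono[OF XV vX] by (intro run_unique[symmetric])
qed

lemma pi_word_swords: "X \<subseteq> V \<Longrightarrow> \<omega> \<in> swords V \<Longrightarrow> pi_word X \<omega> \<in> swords X"
  using run_swords[OF _ reduced_one] .

lemma incl_retr_class:
  assumes "X \<subseteq> V" "\<omega> \<in> swords V"
  shows "artin_incl \<Gamma> (retr \<Gamma> X (artin_class \<Gamma> \<omega>)) = artin_class \<Gamma> (pi_word X \<omega>)"
  using assms pi_word_swords by (simp add: retr_class artin_incl_class)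

end

theorem corollary0p4:
  fixes \<Gamma> :: "'a lgraph" and X :: "'a set"
  assumes "labelled_simplicial_graph \<Gamma>"
    and "X \<subseteq> verts \<Gamma>"
  shows
    "(retr \<Gamma> X \<in> carrier (artin_group \<Gamma>) \<rightarrow> carrier (artin_group (full_subgraph \<Gamma> X)) \<and>
      (\<forall>g \<in> carrier (artin_group (full_subgraph \<Gamma> X)).
        retr \<Gamma> X (artin_incl \<Gamma> g) = g)) \<and>
     (\<forall>g \<in> carrier (artin_group (full_subgraph \<Gamma> X)). \<forall>g' \<in> carrier (artin_group \<Gamma>).
        retr \<Gamma> X (artin_incl \<Gamma> g \<otimes>\<^bsub>artin_group \<Gamma>\<^esub> g') =
          g \<otimes>\<^bsub>artin_group (full_subgraph \<Gamma> X)\<^esub> retr \<Gamma> X g') \<and>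
     (\<forall>Y. Y \<subseteq> verts \<Gamma> \<longrightarrow> (\<forall>g \<in> carrier (artin_group \<Gamma>).
        artin_incl \<Gamma> (retr \<Gamma> Y (artin_incl \<Gamma> (retr \<Gamma> X g))) =
          artin_incl \<Gamma> (retr \<Gamma> X (artin_incl \<Gamma> (retr \<Gamma> Y g))) \<and>
        artin_incl \<Gamma> (retr \<Gamma> X (artin_incl \<Gamma> (retr \<Gamma> Y g))) =
          artin_incl \<Gamma> (retr \<Gamma> (X \<inter> Y) g))) \<and>
     (\<forall>Y. X \<subseteq> Y \<and> Y \<subseteq> verts \<Gamma> \<longrightarrow>
        (\<forall>g \<in> carrier (artin_group (full_subgraph \<Gamma> Y)).
          retr \<Gamma> X (artin_incl \<Gamma> g) = retr (full_subgraph \<Gamma> Y) X g) \<and>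
        (\<forall>g \<in> carrier (artin_group \<Gamma>).
          retr (full_subgraph \<Gamma> Y) X (retr \<Gamma> Y g) = retr \<Gamma> X g))"
proof -
  interpret coxeter_graph \<Gamma> by unfold_locales (rule assms(1))
  note X = assms(2)
  have carX: "carrier (artin_group (full_subgraph \<Gamma> Z)) =
      artin_class (full_subgraph \<Gamma> Z) ` swords Z" for Z
    by (simp add: carrier_artin)
  have maps_to: "retr \<Gamma> X \<in> carrier (artin_group \<Gamma>) \<rightarrow> carrier (artin_group (full_subgraph \<Gamma> X))"
    using pi_word_swords[OF X] by (auto simp: carrier_artin retr_class[OF X])
  have retraction: "retr \<Gamma> X (artin_incl \<Gamma> g) = g"
    if "g \<in> carrier (artin_group (full_subgraph \<Gamma> X))" for g
    using that swords_mono[OF X] by (auto simp: carX artin_incl_class[OF _ X] retr_class[OF X] run_id[OF X])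
  have equivariant: "retr \<Gamma> X (artin_incl \<Gamma> g \<otimes>\<^bsub>artin_group \<Gamma>\<^esub> g') =
      g \<otimes>\<^bsub>artin_group (full_subgraph \<Gamma> X)\<^esub> retr \<Gamma> X g'"
    if g: "g \<in> carrier (artin_group (full_subgraph \<Gamma> X))" and g': "g' \<in> carrier (artin_group \<Gamma>)"
    for g g'
  proof -
    obtain u where u: "u \<in> swords X" "g = artin_class (full_subgraph \<Gamma> X) u" using g carX by auto
    obtain v where v: "v \<in> swords V" "g' = artin_class \<Gamma> v" using g' unfolding carrier_artin by blast
    have "u \<in> swords V" using u X swords_mono by blast
    with u v show ?thesis
      using pi_word_swords[OF X v(1)]
      by (simp add: artin_incl_class[OF _ X] artin_class_mult retr_class[OF X] run_left_mult[OF X])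
  qed
  have inter: "artin_incl \<Gamma> (retr \<Gamma> Y (artin_incl \<Gamma> (retr \<Gamma> X g))) =
          artin_incl \<Gamma> (retr \<Gamma> X (artin_incl \<Gamma> (retr \<Gamma> Y g))) \<and>
        artin_incl \<Gamma> (retr \<Gamma> X (artin_incl \<Gamma> (retr \<Gamma> Y g))) =
          artin_incl \<Gamma> (retr \<Gamma> (X \<inter> Y) g)"
    if Y: "Y \<subseteq> V" and g: "g \<in> carrier (artin_group \<Gamma>)" for Y g
  proof -
    obtain v where v: "v \<in> swords V" "g = artin_class \<Gamma> v" using g unfolding carrier_artin by blast
    have "pi_word X v \<in> swords V" "pi_word Y v \<in> swords V" "X \<inter> Y \<subseteq> V"
      using run_swords'[OF _ reduced_one v(1)] X Y by auto
    with v show ?thesis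
      using run_run[OF X Y v(1)] run_run[OF Y X v(1)]
      by (simp add: incl_retr_class[OF X] incl_retr_class[OF Y] incl_retr_class[of "X \<inter> Y"]
          Int_commute)
  qed
  have restriction: "retr \<Gamma> X (artin_incl \<Gamma> g) = retr (full_subgraph \<Gamma> Y) X g"
    if Y: "X \<subseteq> Y" "Y \<subseteq> V" and g: "g \<in> carrier (artin_group (full_subgraph \<Gamma> Y))" for Y g
  proof -
    interpret Y: coxeter_graph "full_subgraph \<Gamma> Y"
      by unfold_locales (rule labelled_simplicial_full[OF simplicial Y(2)])
    obtain v where v: "v \<in> swords Y" "g = artin_class (full_subgraph \<Gamma> Y) v" using g carX by auto
    show ?thesis
      using v Y swords_mono[OF Y(2) v(1)]
      by (simp add: artin_incl_class retr_class[OF X] Y.retr_class pi_word_subgraph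
          full_subgraph_trans)
  qed
  have composition: "retr (full_subgraph \<Gamma> Y) X (retr \<Gamma> Y g) = retr \<Gamma> X g"
    if Y: "X \<subseteq> Y" "Y \<subseteq> V" and g: "g \<in> carrier (artin_group \<Gamma>)" for Y g
  proof -
    interpret Y: coxeter_graph "full_subgraph \<Gamma> Y"
      by unfold_locales (rule labelled_simplicial_full[OF simplicial Y(2)])
    obtain v where v: "v \<in> swords V" "g = artin_class \<Gamma> v" using g unfolding carrier_artin by blast
    have "Y \<inter> X = X" using Y by blast
    then show ?thesis
      using v Y pi_word_swords[OF Y(2) v(1)] run_run[OF Y(2) X v(1)]
      by (simp add: retr_class[OF X] retr_class[OF Y(2)] Y.retr_class pi_word_subgraph
          full_subgraph_trans)
  qed
  show ?thesis
    by (intro conjI ballI allI impI; (elim conjE)?)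
      (rule maps_to retraction equivariant conjunct1[OF inter] conjunct2[OF inter]
        restriction composition; assumption)+
qed

end
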